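(* For every real $\varepsilon > 0$, there exists $q_0$ such that for all integers $q\ge q_0$ the following holds: If $G$ is a simple graph that is properly edge colored with $(2+\varepsilon)q$ colors, with at least $(2+\varepsilon)qr$ edges for some integer $r\le q$, and such that no color appears on more than $q$ edges, then $G$ has a rainbow matching of size $r$.
   Context: A proper edge coloring assigns colors to edges so that edges sharing a vertex get different colors. A matching is rainbow if its edges have pairwise distinct colors. *)

theory Defs
  imports Complex_Main "HOL-Library.Disjoint_Sets"
begin

definition simple_graph :: "'v set \<Rightarrow> 'v set set \<Rightarrow> bool" where
  "simple_graph V E \<longleftrightarrow> (\<forall>e\<in>E. e \<subseteq> V \<and> card e = 2)"

(* C is the palette; colors in C need not all be used. *)
definition proper_edge_coloring :: "'v set set \<Rightarrow> 'c set \<Rightarrow> ('v set \<Rightarrow> 'c) \<Rightarrow> bool" where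
  "proper_edge_coloring E C c \<longleftrightarrow>
     c ` E \<subseteq> C \<and> (\<forall>e\<in>E. \<forall>f\<in>E. e \<noteq> f \<and> e \<inter> f \<noteq> {} \<longrightarrow> c e \<noteq> c f)"

definition matching :: "'v set set \<Rightarrow> 'v set set \<Rightarrow> bool" where
  "matching E M \<longleftrightarrow> M \<subseteq> E \<and> disjoint M"

definition rainbow_matching :: "'v set set \<Rightarrow> ('v set \<Rightarrow> 'c) \<Rightarrow> 'v set set \<Rightarrow> bool" where
  "rainbow_matching E c M \<longleftrightarrow> matching E M \<and> inj_on c M"

end

theory Submission
  imports Defs "HOL-Analysis.Convex"
begin

text \<open>
  Let \<open>M\<close> be a maximum rainbow matching and suppose it has fewer than \<open>r\<close> edges. Vertices outside \<open>M\<close> and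
  colours not used by \<open>M\<close> are free. In boundedly many rounds the free sets are enlarged by vertices and
  colours of \<open>M\<close> that can be freed in many ways by exchanging boundedly many edges, keeping the
  size: either an edge of \<open>M\<close> is rotated about one endpoint to a free vertex in a free colour, which frees the
  other endpoint and the colour, or four edges of \<open>M\<close> are replaced by four edges of distinct free
  colours on the same eight vertices, which frees their colours. By maximality no edge is completely free.

  Once a round frees few new vertices and colours, let \<open>t\<close> edges of \<open>M\<close> have neither endpoints nor colour
  free and \<open>v\<close> edges only the colour free; put \<open>g = t + v\<close>. The free-coloured pairs meeting
  the \<open>t\<close> edges and their images under the involution swapping the ends of each edge of \<open>M\<close> overlap in few pairs,
  since a dense overlap contains many 4-cycles, each of which gives an exchange of the second kind.
  Hence, with \<open>D = (2 + \<epsilon>) q\<close>, up to lower order terms the graph has at most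
  \<open>D (|M| - g) + q t + 2 v\<^sup>2 + t\<^sup>2 + 2 t v \<le> D (|M| - g) + 2 q g\<close> edges, which is less than \<open>D r\<close>.
\<close>

section \<open>Exchanges in a rainbow matching, and counting tools\<close>

text \<open>Every change of a matching below is an instance: adding an edge (\<open>Y\<close>
  empty), a rotation (one edge for one) and the exchange of four edges for four.\<close>

lemma rainbow_matching_swap:
  assumes N: "rainbow_matching E c N" and "finite N" and Y: "Y \<subseteq> N" and A: "A \<subseteq> E" "finite A" "disjoint A" "inj_on c A"
    and dv: "\<Union>A \<inter> \<Union>(N - Y) = {}" and dc: "c ` A \<inter> c ` (N - Y) = {}"
  shows "rainbow_matching E c (N - Y \<union> A)" "card (N - Y \<union> A) = card N - card Y + card A"
proof -
  have disjN: "disjoint N" and NE: "N \<subseteq> E" and inj: "inj_on c N"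
    using N by (auto simp: rainbow_matching_def matching_def)
  have "disjoint (N - Y)" "inj_on c (N - Y)"
    using disjN inj by (auto simp: disjoint_def inj_on_def)
  then have "disjoint (N - Y \<union> A)" "inj_on c (N - Y \<union> A)"
    using A dv dc by (blast intro: disjoint_union, auto simp: inj_on_Un)
  then show "rainbow_matching E c (N - Y \<union> A)"
    using NE A by (auto simp: rainbow_matching_def matching_def)
  have "(N - Y) \<inter> A = {}" using dc by auto
  then have "card (N - Y \<union> A) = card (N - Y) + card A"
    using \<open>finite N\<close> A by (simp add: card_Un_disjoint)
  then show "card (N - Y \<union> A) = card N - card Y + card A"
    using card_Diff_subset[of Y N] Y \<open>finite N\<close> finite_subset by metis
qed

text \<open>Cauchy-Schwarz, applied twice, gives at least |G|^4 / (|T|^2 |S|^2) closed 4-walks in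
  the bipartite graph \<open>G\<close>, degenerate ones included. At most \<open>B\<close> of them
  start at each \<open>u\<close>, hence at most |T| B exist.\<close>

lemma four_cycle_count:
  fixes B :: nat
  assumes "finite T" "finite S" "G \<subseteq> T \<times> S"
    and B: "\<And>u. u \<in> T \<Longrightarrow>
      card {(w, u', w') \<in> S \<times> T \<times> S. (u, w) \<in> G \<and> (u', w) \<in> G \<and> (u', w') \<in> G \<and> (u, w') \<in> G} \<le> B"
  shows "(card G) ^ 4 \<le> (card T) ^ 3 * (card S)\<^sup>2 * B"
proof -
  define a :: "'a \<Rightarrow> 'b \<Rightarrow> real" where "a u w = of_bool ((u, w) \<in> G)" for u w
  \<comment> \<open>The codegree of \<open>u\<close> and \<open>u'\<close>; the squares of the
    codegrees sum to the number of closed 4-walks.\<close>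
  define p where "p u u' = (\<Sum>w\<in>S. a u w * a u' w)" for u u'
  have "real (card G) = (\<Sum>x\<in>T \<times> S. of_bool (x \<in> G))"
    using assms(1-3) by (simp add: sum_of_bool_eq Int_absorb1)
  also have "\<dots> = (\<Sum>u\<in>T. \<Sum>w\<in>S. a u w)"
    by (simp add: a_def sum.cartesian_product case_prod_unfold)
  also have "\<dots> = (\<Sum>w\<in>S. \<Sum>u\<in>T. a u w)" by (rule sum.swap)
  finally have G: "real (card G) = (\<Sum>w\<in>S. \<Sum>u\<in>T. a u w)" .
  \<comment> \<open>First Cauchy-Schwarz, over the degrees in \<open>S\<close>; expanding the
    squares turns them into codegrees.\<close>
  have "(real (card G))\<^sup>2 \<le> (\<Sum>w\<in>S. (\<Sum>u\<in>T. a u w)\<^sup>2) * card S"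
    unfolding G by (rule sum_squared_le_sum_of_squares)
  also have "(\<Sum>w\<in>S. (\<Sum>u\<in>T. a u w)\<^sup>2) = (\<Sum>w\<in>S. \<Sum>u\<in>T. \<Sum>u'\<in>T. a u w * a u' w)"
    by (simp add: power2_eq_square sum_product)
  also have "\<dots> = (\<Sum>u\<in>T. \<Sum>w\<in>S. \<Sum>u'\<in>T. a u w * a u' w)" by (rule sum.swap)
  also have "\<dots> = (\<Sum>u\<in>T. \<Sum>u'\<in>T. p u u')"
    unfolding p_def by (intro sum.cong refl sum.swap)
  also have "\<dots> = (\<Sum>x\<in>T \<times> T. p (fst x) (snd x))"
    by (simp add: sum.cartesian_product case_prod_unfold)
  finally have 1: "(real (card G))\<^sup>2 \<le> (\<Sum>x\<in>T \<times> T. p (fst x) (snd x)) * card S" .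
  \<comment> \<open>Second Cauchy-Schwarz, over the codegrees.\<close>
  have "(\<Sum>x\<in>T \<times> T. p (fst x) (snd x))\<^sup>2 \<le> (\<Sum>x\<in>T \<times> T. (p (fst x) (snd x))\<^sup>2) * card (T \<times> T)"
    by (rule sum_squared_le_sum_of_squares)
  also have "(\<Sum>x\<in>T \<times> T. (p (fst x) (snd x))\<^sup>2) = (\<Sum>u\<in>T. \<Sum>u'\<in>T. (p u u')\<^sup>2)"
    by (simp add: sum.cartesian_product case_prod_unfold)
  also have "\<dots> \<le> (\<Sum>u\<in>T. real B)"
  proof (rule sum_mono)
    fix u assume u: "u \<in> T"
    let ?P = "\<lambda>(w, u', w'). (u, w) \<in> G \<and> (u', w) \<in> G \<and> (u', w') \<in> G \<and> (u, w') \<in> G"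
    have "(\<Sum>u'\<in>T. (p u u')\<^sup>2) = (\<Sum>u'\<in>T. \<Sum>w\<in>S. \<Sum>w'\<in>S. (a u w * a u' w) * (a u w' * a u' w'))"
      by (simp add: p_def power2_eq_square sum_product)
    also have "\<dots> = (\<Sum>w\<in>S. \<Sum>u'\<in>T. \<Sum>w'\<in>S. (a u w * a u' w) * (a u w' * a u' w'))"
      by (rule sum.swap)
    also have "\<dots> = (\<Sum>w\<in>S. \<Sum>u'\<in>T. \<Sum>w'\<in>S. of_bool (?P (w, u', w')))"
      by (intro sum.cong refl) (auto simp: a_def)
    also have "\<dots> = (\<Sum>x\<in>S \<times> T \<times> S. of_bool (?P x))"
      by (simp add: sum.cartesian_product case_prod_unfold)
    also have "\<dots> = real (card {x \<in> S \<times> T \<times> S. ?P x})"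
      using assms(1,2) by (simp add: sum_of_bool_eq Collect_conj_eq)
    also have "{x \<in> S \<times> T \<times> S. ?P x} =
        {(w, u', w') \<in> S \<times> T \<times> S. (u, w) \<in> G \<and> (u', w) \<in> G \<and> (u', w') \<in> G \<and> (u, w') \<in> G}" by auto
    also have "real (card \<dots>) \<le> real B" using B[OF u] by simp
    finally show "(\<Sum>u'\<in>T. (p u u')\<^sup>2) \<le> real B" .
  qed
  finally have 2: "(\<Sum>x\<in>T \<times> T. p (fst x) (snd x))\<^sup>2 \<le> real (card T) * real B * real (card T * card T)"
    by (simp add: card_cartesian_product mult_right_mono)
  have "(real (card G)) ^ 4 = ((real (card G))\<^sup>2)\<^sup>2" by simp
  also have "\<dots> \<le> ((\<Sum>x\<in>T \<times> T. p (fst x) (snd x)) * card S)\<^sup>2"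
    using 1 by (intro power_mono) auto
  also have "\<dots> = (\<Sum>x\<in>T \<times> T. p (fst x) (snd x))\<^sup>2 * (card S)\<^sup>2"
    by (simp add: power_mult_distrib)
  also have "\<dots> \<le> (real (card T) * real B * real (card T * card T)) * (card S)\<^sup>2"
    using 2 by (intro mult_right_mono) auto
  also have "\<dots> = real ((card T) ^ 3 * (card S)\<^sup>2 * B)"
    by (simp add: power3_eq_cube)
  finally have "real ((card G) ^ 4) \<le> real ((card T) ^ 3 * (card S)\<^sup>2 * B)" by simp
  then show ?thesis by (simp only: of_nat_le_iff)
qed

lemma card_doubletons_meeting:
  assumes "finite S" "T \<subseteq> S"
  shows "card {e. e \<subseteq> S \<and> card e = 2 \<and> e \<inter> T \<noteq> {}} + (card (S - T) choose 2) = card S choose 2"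
proof -
  have "{e. e \<subseteq> S \<and> card e = 2} = {e. e \<subseteq> S \<and> card e = 2 \<and> e \<inter> T \<noteq> {}} \<union> {e. e \<subseteq> S - T \<and> card e = 2}"
    by auto
  moreover have "finite {e. e \<subseteq> S \<and> card e = 2}" using assms(1) by simp
  ultimately have "card {e. e \<subseteq> S \<and> card e = 2} =
      card {e. e \<subseteq> S \<and> card e = 2 \<and> e \<inter> T \<noteq> {}} + card {e. e \<subseteq> S - T \<and> card e = 2}"
    by (subst card_Un_disjoint[symmetric]) auto
  then show ?thesis using n_subsets[OF assms(1), of 2] n_subsets[of "S - T" 2] assms(1) by simp
qed

text \<open>Written additively, so that linear arithmetic meets no truncated subtraction.\<close>

lemma even_choose_two: "((2 * n) choose 2) + n = 2 * n\<^sup>2"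
proof -
  have "(2 * n) choose 2 = n * (2 * n - 1)" by (simp add: choose_two)
  then show ?thesis by (cases n) (auto simp: power2_eq_square)
qed

section \<open>The maximum rainbow matching and its partner involution\<close>

locale max_rainbow_matching =
  fixes E :: "'v set set" and c :: "'v set \<Rightarrow> 'c" and M :: "'v set set"
  assumes finite_E: "finite E"
    and card_edge: "e \<in> E \<Longrightarrow> card e = 2"
    and proper: "e \<in> E \<Longrightarrow> f \<in> E \<Longrightarrow> e \<noteq> f \<Longrightarrow> e \<inter> f \<noteq> {} \<Longrightarrow> c e \<noteq> c f"
    and M: "rainbow_matching E c M"
    and maximum: "rainbow_matching E c N \<Longrightarrow> card N \<le> card M"
begin

abbreviation VM :: "'v set" where "VM \<equiv> \<Union>M"

text \<open>As the edges of \<open>M\<close> are disjoint pairs, this is the involution swapping the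
  ends of each edge; outside \<open>VM\<close> its value is arbitrary.\<close>

definition partner :: "'v \<Rightarrow> 'v" where
  "partner u = (SOME w. {u, w} \<in> M)"

lemma M_sub: "M \<subseteq> E" and disjoint_M: "disjoint M" and inj_c_M: "inj_on c M"
  using M by (auto simp: rainbow_matching_def matching_def)

lemma finite_M: "finite M"
  using M_sub finite_E finite_subset by blast

lemma finite_rainbow_matching: "rainbow_matching E c N \<Longrightarrow> finite N"
  using finite_E finite_subset by (auto simp: rainbow_matching_def matching_def)

lemma edge_neq: "{u, w} \<in> E \<Longrightarrow> u \<noteq> w"
  using card_edge[of "{u, w}"] by auto

lemma partner_edge: assumes "u \<in> VM" shows "{u, partner u} \<in> M"
proof -
  obtain e where e: "e \<in> M" "u \<in> e" using assms by auto
  then obtain x y where "e = {x, y}" using card_edge[of e] M_sub by (auto simp: card_2_iff)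
  then have "\<exists>w. {u, w} \<in> M" using e by (auto simp: insert_commute)
  then show ?thesis unfolding partner_def by (rule someI_ex)
qed

lemma partner_neq [simp]: "u \<in> VM \<Longrightarrow> partner u \<noteq> u" "u \<in> VM \<Longrightarrow> u \<noteq> partner u"
  using partner_edge[of u] edge_neq[of u "partner u"] M_sub by auto

lemma partner_VM [simp]: "u \<in> VM \<Longrightarrow> partner u \<in> VM"
  using partner_edge by blast

lemma M_edge_eq: "e \<in> M \<Longrightarrow> u \<in> e \<Longrightarrow> e = {u, partner u}"
  using partner_edge[of u] disjointD[OF disjoint_M, of e "{u, partner u}"] by auto

lemma partner_partner [simp]: assumes "u \<in> VM" shows "partner (partner u) = u"
proof -
  have "{u, partner u} = {partner u, partner (partner u)}"
    using M_edge_eq partner_edge assms by blast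
  then show ?thesis using assms by (auto simp: doubleton_eq_iff)
qed

lemma inj_partner: "inj_on partner VM"
  by (metis inj_onI partner_partner)

lemma partner_eq_iff: "u \<in> VM \<Longrightarrow> w \<in> VM \<Longrightarrow> partner u = partner w \<longleftrightarrow> u = w"
  using inj_partner by (auto simp: inj_on_def)

text \<open>Properness in the form used for counting: a colour and one end determine the other end,
  so prescribing a colour costs one degree of freedom.\<close>

lemma edge_colour_inj:
  assumes "{x, y} \<in> E" "{x, z} \<in> E" "c {x, y} = c {x, z}" shows "y = z"
  using proper[OF assms(1,2)] assms(3) by (auto simp: doubleton_eq_iff)

lemma finite_VM: "finite VM"
proof -
  have "finite e" if "e \<in> M" for e
    using that card_edge[of e] M_sub card_ge_0_finite[of e] by auto
  then show ?thesis using finite_M by blast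
qed

lemma card_Union_M:
  assumes "A \<subseteq> M" shows "card (\<Union>A) = 2 * card A"
proof -
  have "card (\<Union>A) = sum card A"
    using assms disjoint_M finite_VM by (intro card_Union_disjoint)
      (auto simp: disjoint_def pairwise_def disjnt_def intro: finite_subset[of _ VM])
  also have "\<dots> = (\<Sum>e\<in>A. 2)" using assms M_sub card_edge by (intro sum.cong) auto
  finally show ?thesis by simp
qed

section \<open>Vertices and colours that can be freed together\<close>

text \<open>\<open>Z\<close> is a set of edges that the exchanged matching must retain; it makes exchanges composable.\<close>
definition freeable :: "nat \<Rightarrow> 'v set \<Rightarrow> 'c set \<Rightarrow> bool" where
  "freeable b W C \<longleftrightarrow> (\<forall>TV TC Z. TV \<subseteq> W \<longrightarrow> TC \<subseteq> C \<longrightarrow> Z \<subseteq> M \<longrightarrow> finite TV \<longrightarrow> finite TC \<longrightarrow>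
     card TV + card TC + card Z \<le> b \<longrightarrow> \<Union>Z \<inter> TV = {} \<longrightarrow> c ` Z \<inter> TC = {} \<longrightarrow>
     (\<exists>N. rainbow_matching E c N \<and> card N = card M \<and> Z \<subseteq> N \<and> \<Union>N \<inter> TV = {} \<and> c ` N \<inter> TC = {}))"

lemma freeable_mono: "freeable b W C \<Longrightarrow> b' \<le> b \<Longrightarrow> freeable b' W C"
  unfolding freeable_def by (meson le_trans)

lemma freeable_initial: "freeable b (- VM) (- c ` M)"
  unfolding freeable_def
proof (intro allI impI exI[of _ M] conjI)
  fix TV TC assume "TV \<subseteq> - VM" "TC \<subseteq> - c ` M"
  then show "VM \<inter> TV = {}" "c ` M \<inter> TC = {}" by auto
qed (use M in auto)

text \<open>Vacating both ends and the colour would let the edge be added to a rainbow matching of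
  size |M|, against maximality. The 3 counts two vertices and one colour.\<close>

lemma freeable_no_edge:
  assumes fr: "freeable b W C" and "b \<ge> 3" and e: "{x, y} \<in> E" "x \<in> W" "y \<in> W" 
  shows "c {x, y} \<notin> C"
proof
  assume cC: "c {x, y} \<in> C"
  have "card {x, y} + card {c {x, y}} + card ({} :: 'v set set) \<le> b"
    using assms card_edge[OF e(1)] by simp
  then obtain N where N: "rainbow_matching E c N" "card N = card M" "\<Union>N \<inter> {x, y} = {}" "c ` N \<inter> {c {x, y}} = {}"
    using fr[unfolded freeable_def, rule_format, of "{x, y}" "{c {x, y}}" "{}"] e cC by auto
  have "rainbow_matching E c (N - {} \<union> {{x, y}})" "card (N - {} \<union> {{x, y}}) = card N - card ({} :: 'v set set) + card {{x, y}}"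
    by (rule rainbow_matching_swap[OF N(1) finite_rainbow_matching[OF N(1)]]; use N e in auto)+
  then show False using maximum[of "N - {} \<union> {{x, y}}"] N(2) by simp
qed

section \<open>One round of freeing: rotations and four-edge exchanges\<close>

definition star :: "'v set \<Rightarrow> 'c set \<Rightarrow> 'v \<Rightarrow> 'v set" where
  "star W C x = {z \<in> W. {x, z} \<in> E \<and> c {x, z} \<in> C}"

text \<open>Having \<open>K\<close> candidates for the new end of the rotated edge leaves one that
  avoids any fewer than \<open>K\<close> forbidden vertices and colours.\<close>

definition rich :: "nat \<Rightarrow> 'v set \<Rightarrow> 'c set \<Rightarrow> 'v set \<Rightarrow> bool" where
  "rich K W C e \<longleftrightarrow> e \<in> M \<and> e \<inter> W = {} \<and> (\<exists>x\<in>e. K \<le> card (star W C x))"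

text \<open>The end about which the edge is rotated. It stays covered, so only its partner joins
  \<open>next_V\<close>.\<close>

definition anchor :: "nat \<Rightarrow> 'v set \<Rightarrow> 'c set \<Rightarrow> 'v set \<Rightarrow> 'v" where
  "anchor K W C e = (SOME x. x \<in> e \<and> K \<le> card (star W C x))"

fun walk_colours :: "'v \<Rightarrow> 'v \<times> 'v \<times> 'v \<Rightarrow> 'c list" where
  "walk_colours u (x, y, z) = [c {u, x}, c {partner x, partner y}, c {y, z}, c {partner z, partner u}]"

text \<open>If all pairs of the 4-cycle \<open>u, x, y, z\<close> and their images under \<^term>\<open>partner\<close> are edges, then these
  four edges cover both ends of the four matching edges at \<open>u, x, y, z\<close> exactly once.\<close>
definition walks :: "'c set \<Rightarrow> 'v \<Rightarrow> ('v \<times> 'v \<times> 'v) set" where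
  "walks C u = {(x, y, z). x \<in> VM \<and> y \<in> VM \<and> z \<in> VM \<and>
     {u, x} \<in> E \<and> {partner x, partner y} \<in> E \<and> {y, z} \<in> E \<and> {partner z, partner u} \<in> E \<and>
     set (walk_colours u (x, y, z)) \<subseteq> C}"

text \<open>The walks that give a valid exchange: distinctness makes the four new edges a rainbow
  matching. Staying off \<open>W\<close> (for \<open>u\<close> this is asked in
  \<open>next_C\<close>) makes the exchange compatible with keeping vertices of \<open>W\<close>
  uncovered.\<close>

definition swaps :: "'v set \<Rightarrow> 'c set \<Rightarrow> 'v \<Rightarrow> ('v \<times> 'v \<times> 'v) set" where
  "swaps W C u = {(x, y, z) \<in> walks C u.
     distinct [u, partner u, x, partner x, y, partner y, z, partner z] \<and>
     distinct (walk_colours u (x, y, z)) \<and>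
     {x, partner x, y, partner y, z, partner z} \<inter> W = {}}"

definition next_V :: "nat \<Rightarrow> 'v set \<Rightarrow> 'c set \<Rightarrow> 'v set" where
  "next_V K W C = W \<union> {partner (anchor K W C e) | e. rich K W C e}"

definition next_C :: "nat \<Rightarrow> nat \<Rightarrow> 'v set \<Rightarrow> 'c set \<Rightarrow> 'c set" where
  "next_C K L W C = C \<union> {c e | e. rich K W C e} \<union>
     {c {u, partner u} | u. u \<in> VM \<and> u \<notin> W \<and> partner u \<notin> W \<and> L \<le> card (swaps W C u)}"

lemma anchor: assumes "rich K W C e" shows "anchor K W C e \<in> e" "K \<le> card (star W C (anchor K W C e))"
proof -
  have "\<exists>x. x \<in> e \<and> K \<le> card (star W C x)" using assms by (auto simp: rich_def)
  from someI_ex[OF this] show "anchor K W C e \<in> e" "K \<le> card (star W C (anchor K W C e))"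
    by (auto simp: anchor_def)
qed

lemma finite_star: "finite (star W C x)"
proof -
  have "star W C x \<subseteq> \<Union>E" by (auto simp: star_def)
  moreover have "finite e" if "e \<in> E" for e
    using that card_edge[of e] card_ge_0_finite[of e] by auto
  then have "finite (\<Union>E)" using finite_E by blast
  ultimately show ?thesis using finite_subset by metis
qed

lemma inj_on_star: "inj_on (\<lambda>z. c {x, z}) (star W C x)"
  using edge_colour_inj by (auto simp: inj_on_def star_def)

text \<open>By properness each forbidden colour excludes at most one \<open>z\<close>, just as each
  forbidden vertex does.\<close>

lemma star_avoiding:
  assumes "K \<le> card (star W C x)" "card FV + card FC < K" "finite FV" "finite FC"
  obtains z where "z \<in> star W C x" "z \<notin> FV" "c {x, z} \<notin> FC"
proof -
  let ?B = "{z \<in> star W C x. c {x, z} \<in> FC}"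
  have "card ?B \<le> card FC"
    by (rule card_inj_on_le[of "\<lambda>z. c {x, z}"]) (use inj_on_star assms in \<open>auto simp: inj_on_def\<close>)
  then have "card (FV \<union> ?B) < card (star W C x)"
    using card_Un_le[of FV ?B] assms by linarith
  then have "\<not> star W C x \<subseteq> FV \<union> ?B"
    using card_mono[of "FV \<union> ?B" "star W C x"] assms(3) finite_star[of W C x] by auto
  then show ?thesis using that by blast
qed

section \<open>Counting walks under one constraint\<close>

lemma walks_sub: "walks C u \<subseteq> VM \<times> VM \<times> VM"
  by (auto simp: walks_def)

text \<open>A condition that determines one of the three vertices from the other two leaves
  quadratically many walks. Colour conditions and coincidences of vertices are bounded in this
  way.\<close>

lemma card_triples:
  assumes "B \<subseteq> walks C u"
  shows "inj_on (\<lambda>(x, y, z). (y, z)) B \<Longrightarrow> card B \<le> (card VM)\<^sup>2"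
    and "inj_on (\<lambda>(x, y, z). (x, z)) B \<Longrightarrow> card B \<le> (card VM)\<^sup>2"
    and "inj_on (\<lambda>(x, y, z). (x, y)) B \<Longrightarrow> card B \<le> (card VM)\<^sup>2"
proof -
  have *: "card B \<le> (card VM)\<^sup>2" if "inj_on f B" "f ` B \<subseteq> VM \<times> VM" for f :: "_ \<Rightarrow> 'v \<times> 'v"
    using card_inj_on_le[OF that] finite_VM by (simp add: card_cartesian_product power2_eq_square)
  show "inj_on (\<lambda>(x, y, z). (y, z)) B \<Longrightarrow> card B \<le> (card VM)\<^sup>2"
    by (rule *) (use order.trans[OF assms walks_sub] in auto)
  show "inj_on (\<lambda>(x, y, z). (x, z)) B \<Longrightarrow> card B \<le> (card VM)\<^sup>2"
    by (rule *) (use order.trans[OF assms walks_sub] in auto)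
  show "inj_on (\<lambda>(x, y, z). (x, y)) B \<Longrightarrow> card B \<le> (card VM)\<^sup>2"
    by (rule *) (use order.trans[OF assms walks_sub] in auto)
qed

lemma finite_walks: "finite (walks C u)"
  using walks_sub finite_VM by (meson finite_SigmaI finite_subset)

lemma walksD:
  assumes "(x, y, z) \<in> walks C u"
  shows "x \<in> VM" "y \<in> VM" "z \<in> VM" "{u, x} \<in> E" "{partner x, partner y} \<in> E" "{y, z} \<in> E"
    "{partner z, partner u} \<in> E" 
  using assms by (auto simp: walks_def)

lemma partner_colour_inj:
  assumes "{partner x, partner y} \<in> E" "{partner x, partner z} \<in> E"
    "c {partner x, partner y} = c {partner x, partner z}" "y \<in> VM" "z \<in> VM"
  shows "y = z"
  using edge_colour_inj[OF assms(1-3)] assms(4,5) by (simp add: partner_eq_iff)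

lemma partner_colour_inj':
  assumes "{partner y, partner x} \<in> E" "{partner z, partner x} \<in> E"
    "c {partner y, partner x} = c {partner z, partner x}" "y \<in> VM" "z \<in> VM"
  shows "y = z"
  using partner_colour_inj[of x y z] assms by (simp add: insert_commute)

text \<open>At each of the four positions the colour determines one vertex: \<open>x\<close> from
  \<open>u\<close>, \<open>y\<close> from \<open>x\<close>, \<open>z\<close> from \<open>y\<close>,
  and \<open>z\<close> from \<open>u\<close>.\<close>

lemma card_walks_colour:
  assumes "u \<in> VM"
  shows "card {w \<in> walks C u. k \<in> set (walk_colours u w)} \<le> 4 * (card VM)\<^sup>2"
proof -
  let ?B1 = "{(x, y, z) \<in> walks C u. c {u, x} = k}"
  let ?B2 = "{(x, y, z) \<in> walks C u. c {partner x, partner y} = k}"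
  let ?B3 = "{(x, y, z) \<in> walks C u. c {y, z} = k}"
  let ?B4 = "{(x, y, z) \<in> walks C u. c {partner z, partner u} = k}"
  have 1: "card ?B1 \<le> (card VM)\<^sup>2"
    by (rule card_triples(1)[of _ C u]) (auto simp: inj_on_def dest: walksD(4) intro: edge_colour_inj)
  have 2: "card ?B2 \<le> (card VM)\<^sup>2"
    by (rule card_triples(2)[of _ C u]) (auto simp: inj_on_def intro: partner_colour_inj dest: walksD)
  have 3: "card ?B3 \<le> (card VM)\<^sup>2"
    by (rule card_triples(3)[of _ C u]) (auto simp: inj_on_def dest: walksD(6) intro: edge_colour_inj)
  have 4: "card ?B4 \<le> (card VM)\<^sup>2"
    by (rule card_triples(3)[of _ C u])
      (auto simp: inj_on_def intro: partner_colour_inj' dest: walksD)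
  have "{w \<in> walks C u. k \<in> set (walk_colours u w)} \<subseteq> ?B1 \<union> ?B2 \<union> (?B3 \<union> ?B4)"
    by auto
  then have "card {w \<in> walks C u. k \<in> set (walk_colours u w)} \<le> card (?B1 \<union> ?B2 \<union> (?B3 \<union> ?B4))"
    by (intro card_mono) (auto intro: finite_subset[OF _ finite_walks])
  also have "\<dots> \<le> (card ?B1 + card ?B2) + (card ?B3 + card ?B4)"
    by (intro order.trans[OF card_Un_le] add_mono card_Un_le)
  finally show ?thesis using 1 2 3 4 by linarith
qed

lemma card_walks_colours:
  assumes "u \<in> VM" "finite F"
  shows "card {w \<in> walks C u. set (walk_colours u w) \<inter> F \<noteq> {}} \<le> 4 * card F * (card VM)\<^sup>2"
proof -
  have "{w \<in> walks C u. set (walk_colours u w) \<inter> F \<noteq> {}} =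
      (\<Union>k\<in>F. {w \<in> walks C u. k \<in> set (walk_colours u w)})" by auto
  then have "card {w \<in> walks C u. set (walk_colours u w) \<inter> F \<noteq> {}} \<le>
      (\<Sum>k\<in>F. card {w \<in> walks C u. k \<in> set (walk_colours u w)})"
    using card_UN_le[OF assms(2)] by simp
  also have "\<dots> \<le> (\<Sum>k\<in>F. 4 * (card VM)\<^sup>2)"
    by (intro sum_mono card_walks_colour assms)
  finally show ?thesis by simp
qed

lemma card_walks_vertices:
  assumes "finite F"
  shows "card {(x, y, z) \<in> walks C u. {x, y, z} \<inter> F \<noteq> {}} \<le> 3 * card F * (card VM)\<^sup>2"
proof -
  have "{(x, y, z) \<in> walks C u. {x, y, z} \<inter> F \<noteq> {}} \<subseteq> F \<times> VM \<times> VM \<union> (VM \<times> F \<times> VM \<union> VM \<times> VM \<times> F)"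
    using walks_sub by auto
  then have "card {(x, y, z) \<in> walks C u. {x, y, z} \<inter> F \<noteq> {}} \<le>
      card (F \<times> VM \<times> VM \<union> (VM \<times> F \<times> VM \<union> VM \<times> VM \<times> F))"
    using assms finite_VM by (intro card_mono) auto
  also have "\<dots> \<le> card (F \<times> VM \<times> VM) + (card (VM \<times> F \<times> VM) + card (VM \<times> VM \<times> F))"
    by (intro order.trans[OF card_Un_le] add_mono card_Un_le order.refl)
  also have "\<dots> = 3 * card F * (card VM)\<^sup>2"
    by (simp add: card_cartesian_product power2_eq_square)
  finally show ?thesis .
qed

lemma finite_swaps: "finite (swaps W C u)"
  by (rule finite_subset[OF _ finite_walks]) (auto simp: swaps_def)

text \<open>The threshold exceeds the number of walks with a forbidden colour or vertex. Testing
  \<open>x\<close>, \<open>y\<close>, \<open>z\<close> will suffice, since the forbidden vertices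
  will be the ends of edges of \<open>M\<close>, a set closed under \<open>partner\<close>.\<close>

lemma swaps_avoiding:
  assumes "L \<le> card (swaps W C u)" "4 * card FC * (card VM)\<^sup>2 + 3 * card FV * (card VM)\<^sup>2 < L"
    and "finite FV" "finite FC" "u \<in> VM"
  obtains x y z where "(x, y, z) \<in> swaps W C u" "{x, y, z} \<inter> FV = {}"
    "set (walk_colours u (x, y, z)) \<inter> FC = {}"
proof -
  let ?A = "{w \<in> walks C u. set (walk_colours u w) \<inter> FC \<noteq> {}}"
  let ?B = "{(x, y, z) \<in> walks C u. {x, y, z} \<inter> FV \<noteq> {}}"
  have fin: "finite (?A \<union> ?B)"
    by (rule finite_subset[OF _ finite_walks]) auto
  have "card (?A \<union> ?B) < card (swaps W C u)"
    using card_Un_le[of ?A ?B] card_walks_colours[OF assms(5,4)] card_walks_vertices[OF assms(3)] assms(1,2)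
    by (meson add_mono le_trans less_le_trans order.strict_trans1)
  then have "\<not> swaps W C u \<subseteq> ?A \<union> ?B"
    using card_mono[OF fin] by (meson leD)
  then obtain w where w: "w \<in> swaps W C u" "w \<notin> ?A" "w \<notin> ?B" by blast
  obtain x y z where xyz: "w = (x, y, z)" by (cases w)
  have "w \<in> walks C u" using w(1) by (auto simp: swaps_def)
  then show ?thesis using w unfolding xyz by (intro that[of x y z]) auto
qed

section \<open>A round keeps the enlarged sets freeable\<close>

lemma M_edges_disjoint: "e \<in> M \<Longrightarrow> f \<in> M \<Longrightarrow> x \<in> e \<Longrightarrow> x \<in> f \<Longrightarrow> e = f"
  using disjointD[OF disjoint_M] by blast

lemma rainbow_matching_remove:
  assumes "rainbow_matching E c N" "Y \<subseteq> N"
  shows "\<Union>Y \<inter> \<Union>(N - Y) = {}" "c ` Y \<inter> c ` (N - Y) = {}"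
proof -
  have N: "disjoint N" "inj_on c N" using assms by (auto simp: rainbow_matching_def matching_def)
  show "\<Union>Y \<inter> \<Union>(N - Y) = {}"
    using disjointD[OF N(1)] assms(2) by blast
  show "c ` Y \<inter> c ` (N - Y) = {}"
    using N(2) assms(2) by (auto simp: inj_on_def)
qed

text \<open>Induction on the number of demanded elements that are new in this round. To free a new
  one, first ask for a matching that retains the edges to be exchanged and reserves what their
  replacements use; then carry out the exchange in it. A rotation raises the demand by at most 3, a
  four-edge exchange by at most 4 + 4. Since a new element disappears each time, the weight 8 pays
  for this.\<close>

lemma freeable_next_aux:
  assumes fr: "freeable b W C" and K: "3 * b < K" and L: "10 * b * (card VM)\<^sup>2 < L"
  shows "TV \<subseteq> next_V K W C \<Longrightarrow> TC \<subseteq> next_C K L W C \<Longrightarrow> Z \<subseteq> M \<Longrightarrow> finite TV \<Longrightarrow> finite TC \<Longrightarrow>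
     card TV + card TC + card Z + 8 * (card (TV - W) + card (TC - C)) \<le> b \<Longrightarrow>
     \<Union>Z \<inter> TV = {} \<Longrightarrow> c ` Z \<inter> TC = {} \<Longrightarrow>
     (\<exists>N. rainbow_matching E c N \<and> card N = card M \<and> Z \<subseteq> N \<and> \<Union>N \<inter> TV = {} \<and> c ` N \<inter> TC = {})"
proof (induction "card (TV - W) + card (TC - C)" arbitrary: TV TC Z rule: less_induct)
  case less
  note TV = \<open>TV \<subseteq> next_V K W C\<close> and TC = \<open>TC \<subseteq> next_C K L W C\<close> and Z = \<open>Z \<subseteq> M\<close>
    and fin = \<open>finite TV\<close> \<open>finite TC\<close> and b = less.prems(6) and ZV = \<open>\<Union>Z \<inter> TV = {}\<close> and ZC = \<open>c ` Z \<inter> TC = {}\<close>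
  have finZ: "finite Z" using Z finite_M finite_subset by blast
  have finUZ: "finite (\<Union>Z)" using Z finite_VM by (meson Union_mono finite_subset)
  have cUZ: "card (\<Union>Z) = 2 * card Z" using card_Union_M Z by blast
  have cZ: "card (c ` Z) \<le> card Z" using card_image_le finZ by blast
  have FC: "card (TC \<union> c ` Z) \<le> card TC + card Z" using card_Un_le[of TC "c ` Z"] cZ by linarith
  have rich_case: ?case
    if e: "rich K W C e" and new: "partner (anchor K W C e) \<in> TV - W \<or> c e \<in> TC - C" for e
  proof -
    define x where "x = anchor K W C e"
    define y where "y = partner x"
    have eM: "e \<in> M" and eW: "e \<inter> W = {}" using e by (auto simp: rich_def)
    have xe: "x \<in> e" using anchor(1)[OF e] x_def by simp
    then have exy: "e = {x, y}" using M_edge_eq[OF eM] y_def by simp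
    have xVM: "x \<in> VM" using xe eM by blast
    have "x \<noteq> y" using xVM by (simp add: y_def)
    have eZ: "e \<notin> Z"
    proof
      assume "e \<in> Z"
      then have "y \<notin> TV" "c e \<notin> TC" using ZV ZC exy by auto
      then show False using new by (simp add: x_def y_def)
    qed
    \<comment> \<open>At most |TV| + 2 |Z| vertices and |TC| + |Z| colours are forbidden, together
      at most 3 b.\<close>
    have "card (TV \<union> \<Union>Z) + card (TC \<union> c ` Z) < K"
      using card_Un_le[of TV "\<Union>Z"] FC cUZ b K by linarith
    then obtain z where z: "z \<in> star W C x" "z \<notin> TV \<union> \<Union>Z" "c {x, z} \<notin> TC \<union> c ` Z"
      using star_avoiding[OF anchor(2)[OF e, folded x_def], of "TV \<union> \<Union>Z" "TC \<union> c ` Z"] fin finZ finUZ by blast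
    then have zW: "z \<in> W" and xzE: "{x, z} \<in> E" and xzC: "c {x, z} \<in> C" by (auto simp: star_def)
    have "z \<notin> e" using zW eW by blast
    then have zx: "z \<noteq> x" and zy: "z \<noteq> y" using exy by auto
    have "c {x, z} \<noteq> c e"
      using proper[OF xzE, of e] eM M_sub \<open>z \<notin> e\<close> exy by blast
    \<comment> \<open>The rotated edge still covers \<open>x\<close>, so \<open>x\<close> must not
      be demanded: the only vertex of \<open>e\<close> in \<open>next_V\<close> is the partner of
      its anchor.\<close>
    have xTV: "x \<notin> TV"
    proof
      assume "x \<in> TV"
      then obtain f where f: "rich K W C f" "x = partner (anchor K W C f)"
        using TV eW xe by (auto simp: next_V_def)
      have "f = {anchor K W C f, partner (anchor K W C f)}"
        using M_edge_eq[of f] anchor(1)[OF f(1)] f(1) by (auto simp: rich_def)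
      then have "x \<in> f" using f(2) by blast
      then have "f = e" using M_edges_disjoint[of f e x] f(1) eM xe by (auto simp: rich_def)
      then show False using f(2) x_def xVM partner_neq by metis
    qed
    \<comment> \<open>While \<open>e\<close> is retained its end \<open>y\<close> and its colour are
      present, so they leave the demand; \<open>z\<close> and the colour of {x, z} are reserved
      instead.\<close>
    define TV' where "TV' = insert z (TV - {y})"
    define TC' where "TC' = insert (c {x, z}) (TC - {c e})"
    have TV'W: "TV' - W = (TV - W) - {y}" and TC'C: "TC' - C = (TC - C) - {c e}"
      using zW xzC by (auto simp: TV'_def TC'_def)
    have less': "card (TV' - W) + card (TC' - C) < card (TV - W) + card (TC - C)"
    proof -
      have "card (TV' - W) \<le> card (TV - W)" "card (TC' - C) \<le> card (TC - C)"
        unfolding TV'W TC'C using fin by (auto intro!: card_mono)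
      moreover have "card (TV' - W) < card (TV - W) \<or> card (TC' - C) < card (TC - C)"
        unfolding TV'W TC'C using new fin by (auto simp: x_def y_def intro!: card_Diff1_less)
      ultimately show ?thesis by linarith
    qed
    have cTV': "card TV' \<le> card TV + 1"
      using card_insert_le_m1[of _ "TV - {y}" z] card_Diff1_le[of TV y] fin
      by (simp add: TV'_def card_insert_if)
    have cTC': "card TC' \<le> card TC + 1"
      using card_Diff1_le[of TC "c e"] fin by (simp add: TC'_def card_insert_if)
    have cZ': "card (insert e Z) \<le> card Z + 1"
      using finZ by (simp add: card_insert_if)
    have "\<exists>N. rainbow_matching E c N \<and> card N = card M \<and> insert e Z \<subseteq> N \<and> \<Union>N \<inter> TV' = {} \<and> c ` N \<inter> TC' = {}"
    proof (rule less.hyps[OF less'])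
      show "TV' \<subseteq> next_V K W C" using TV zW by (auto simp: TV'_def next_V_def)
      show "TC' \<subseteq> next_C K L W C" using TC xzC by (auto simp: TC'_def next_C_def)
      show "insert e Z \<subseteq> M" using Z eM by simp
      show "finite TV'" "finite TC'" using fin by (auto simp: TV'_def TC'_def)
      show "card TV' + card TC' + card (insert e Z) + 8 * (card (TV' - W) + card (TC' - C)) \<le> b"
      proof -
        have "8 * (card (TV' - W) + card (TC' - C)) + 8 \<le> 8 * (card (TV - W) + card (TC - C))"
          using less' by simp
        then show ?thesis using b cTV' cTC' cZ' by linarith
      qed
      show "\<Union>(insert e Z) \<inter> TV' = {}"
        using exy xTV zx zy z(2) ZV by (auto simp: TV'_def)
      show "c ` insert e Z \<inter> TC' = {}"
        using \<open>c {x, z} \<noteq> c e\<close> z(3) ZC by (auto simp: TC'_def)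
    qed
    then obtain N where N: "rainbow_matching E c N" "card N = card M" "insert e Z \<subseteq> N" "\<Union>N \<inter> TV' = {}" "c ` N \<inter> TC' = {}"
      by blast
    have Ne: "{e} \<subseteq> N" using N(3) by blast
    note rem = rainbow_matching_remove[OF N(1) Ne]
    have zN: "z \<notin> \<Union>N" and cN: "c {x, z} \<notin> c ` N" using N(4,5) by (auto simp: TV'_def TC'_def)
    have dv: "\<Union>{{x, z}} \<inter> \<Union>(N - {e}) = {}"
      using rem(1) xe zN by auto
    have dc: "c ` {{x, z}} \<inter> c ` (N - {e}) = {}" using cN by blast
    have N': "rainbow_matching E c (N - {e} \<union> {{x, z}})"
        "card (N - {e} \<union> {{x, z}}) = card N - card {e} + card {{x, z}}"
      by (rule rainbow_matching_swap[OF N(1) finite_rainbow_matching[OF N(1)] Ne _ _ _ _ dv dc]; use xzE in auto)+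
    have "card N \<ge> 1" using Ne finite_rainbow_matching[OF N(1)] card_gt_0_iff[of N] by (auto simp: Suc_le_eq)
    then have "card (N - {e} \<union> {{x, z}}) = card M" using N'(2) N(2) by simp
    moreover have "Z \<subseteq> N - {e} \<union> {{x, z}}" using N(3) eZ by blast
    moreover have "\<Union>(N - {e} \<union> {{x, z}}) \<inter> TV = {}"
    proof -
      have "w \<notin> TV" if "w \<in> \<Union>(N - {e})" for w
        using that N(4) rem(1) exy by (auto simp: TV'_def)
      then show ?thesis using xTV z(2) by auto
    qed
    moreover have "c ` (N - {e} \<union> {{x, z}}) \<inter> TC = {}"
    proof -
      have "k \<notin> TC" if k: "k \<in> c ` (N - {e})" for k
      proof -
        have "k \<in> c ` N" "k \<noteq> c e" using k rem(2) by blast+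
        then show ?thesis using N(5) unfolding TC'_def by blast
      qed
      then show ?thesis using z(3) by auto
    qed
    ultimately show ?thesis using N'(1) by blast
  qed
  \<comment> \<open>New vertices are treated first, so here \<open>TV\<close> lies in
    \<open>W\<close>; the eight vertices of the exchange avoid \<open>W\<close> and remain
    covered.\<close>
  have swap_case: ?case
    if u: "u \<in> VM" "u \<notin> W" "partner u \<notin> W" "L \<le> card (swaps W C u)" and new: "c {u, partner u} \<in> TC - C"
      and TVW: "TV \<subseteq> W" for u
  proof -
    \<comment> \<open>The forbidden count is at most 4 (|TC| + |Z|) + 6 |Z| \<le> 10 b.\<close>
    have "4 * card (TC \<union> c ` Z) * (card VM)\<^sup>2 + 3 * card (\<Union>Z) * (card VM)\<^sup>2
        = (4 * card (TC \<union> c ` Z) + 3 * card (\<Union>Z)) * (card VM)\<^sup>2" by (simp add: algebra_simps)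
    also have "\<dots> \<le> (10 * b) * (card VM)\<^sup>2"
      using FC cUZ b by (intro mult_right_mono) linarith+
    also have "\<dots> < L" using L .
    finally have "4 * card (TC \<union> c ` Z) * (card VM)\<^sup>2 + 3 * card (\<Union>Z) * (card VM)\<^sup>2 < L" .
    then obtain x y z where xyz: "(x, y, z) \<in> swaps W C u" "{x, y, z} \<inter> \<Union>Z = {}"
        "set (walk_colours u (x, y, z)) \<inter> (TC \<union> c ` Z) = {}"
      using swaps_avoiding[OF u(4), of "TC \<union> c ` Z" "\<Union>Z"] fin finZ finUZ u(1) by blast
    define Y where "Y = {{u, partner u}, {x, partner x}, {y, partner y}, {z, partner z}}"
    define A where "A = {{u, x}, {partner x, partner y}, {y, z}, {partner z, partner u}}"
    have w: "(x, y, z) \<in> walks C u" and dist: "distinct [u, partner u, x, partner x, y, partner y, z, partner z]"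
      and distc: "distinct (walk_colours u (x, y, z))" and xyzW: "{x, partner x, y, partner y, z, partner z} \<inter> W = {}"
      using xyz(1) by (auto simp: swaps_def)
    note wD = walksD[OF w]
    have cA: "c ` A = set (walk_colours u (x, y, z))" by (auto simp: A_def)
    have AC: "c ` A \<subseteq> C" using w unfolding cA by (auto simp: walks_def)
    have AE: "A \<subseteq> E" using wD by (auto simp: A_def)
    have YM: "Y \<subseteq> M" using wD u(1) partner_edge by (auto simp: Y_def)
    have finA: "finite A" by (simp add: A_def)
    \<comment> \<open>Old and new edges cover the same eight vertices, so only colours could
      conflict with the rest of the matching.\<close>
    have UA: "\<Union>A = \<Union>Y" by (auto simp: A_def Y_def)
    have YZ: "Y \<inter> Z = {}"
      using xyz(2) new ZC by (auto simp: Y_def)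
    have YW: "\<Union>Y \<inter> W = {}" using u xyzW by (auto simp: Y_def)
    have cardY: "card Y = 4" using dist by (auto simp: Y_def card_insert_if doubleton_eq_iff)
    have "card (c ` A) = 4" using distinct_card[OF distc] unfolding cA by simp
    moreover have "card A \<le> 4"
      using card_length[of "[{u, x}, {partner x, partner y}, {y, z}, {partner z, partner u}]"] by (simp add: A_def)
    ultimately have cardA: "card A = 4"
      using card_image_le[OF finA, of c] by linarith
    then have injA: "inj_on c A"
      using \<open>card (c ` A) = 4\<close> finA by (intro eq_card_imp_inj_on) auto
    have disjA: "disjoint A" using dist by (auto simp: A_def disjoint_def)
    \<comment> \<open>The colours of \<open>Y\<close> occur while \<open>Y\<close> is retained and
      so leave the demand; those of \<open>A\<close> are reserved. As the latter lie in
      \<open>C\<close>, the number of new colours drops.\<close>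
    define TC' where "TC' = (TC \<union> c ` A) - c ` Y"
    have "TC' - C \<subseteq> (TC - C) - {c {u, partner u}}" using AC by (auto simp: TC'_def Y_def)
    then have less'': "card (TC' - C) < card (TC - C)"
      using new fin by (meson card_Diff1_less card_mono finite_Diff le_less_trans)
    then have less': "card (TV - W) + card (TC' - C) < card (TV - W) + card (TC - C)" by simp
    have "card TC' \<le> card (TC \<union> c ` A)" using fin finA by (auto simp: TC'_def intro!: card_mono)
    also have "\<dots> \<le> card TC + card (c ` A)" by (rule card_Un_le)
    also have "\<dots> \<le> card TC + 4" using card_image_le[OF finA, of c] cardA by simp
    finally have cTC': "card TC' \<le> card TC + 4" .
    have cZ': "card (Z \<union> Y) \<le> card Z + 4" using card_Un_le[of Z Y] cardY by simp
    have "\<exists>N. rainbow_matching E c N \<and> card N = card M \<and> Z \<union> Y \<subseteq> N \<and> \<Union>N \<inter> TV = {} \<and> c ` N \<inter> TC' = {}"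
    proof (rule less.hyps[OF less'])
      show "TV \<subseteq> next_V K W C" by (rule TV)
      show "TC' \<subseteq> next_C K L W C" using TC AC by (auto simp: TC'_def next_C_def)
      show "Z \<union> Y \<subseteq> M" using Z YM by simp
      show "finite TV" "finite TC'" using fin finA by (auto simp: TC'_def)
      show "card TV + card TC' + card (Z \<union> Y) + 8 * (card (TV - W) + card (TC' - C)) \<le> b"
      proof -
        have "8 * (card (TV - W) + card (TC' - C)) + 8 \<le> 8 * (card (TV - W) + card (TC - C))"
          using less'' by simp
        then show ?thesis using b cTC' cZ' by linarith
      qed
      show "\<Union>(Z \<union> Y) \<inter> TV = {}"
        using ZV YW TVW by blast
      show "c ` (Z \<union> Y) \<inter> TC' = {}"
        using ZC xyz(3) unfolding cA[symmetric] by (auto simp: TC'_def)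
    qed
    then obtain N where N: "rainbow_matching E c N" "card N = card M" "Z \<union> Y \<subseteq> N" "\<Union>N \<inter> TV = {}" "c ` N \<inter> TC' = {}"
      by blast
    have NY: "Y \<subseteq> N" using N(3) by blast
    note rem = rainbow_matching_remove[OF N(1) NY]
    have dv: "\<Union>A \<inter> \<Union>(N - Y) = {}" using rem(1) UA by simp
    have dc: "c ` A \<inter> c ` (N - Y) = {}" using rem(2) N(5) unfolding TC'_def by blast
    note N' = rainbow_matching_swap[OF N(1) finite_rainbow_matching[OF N(1)] NY AE finA disjA injA dv dc]
    have "card N \<ge> 4" using card_mono[OF finite_rainbow_matching[OF N(1)] NY] cardY by simp
    then have "card (N - Y \<union> A) = card M" using N'(2) N(2) cardA cardY by simp
    moreover have "Z \<subseteq> N - Y \<union> A" using N(3) YZ by blast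
    moreover have "\<Union>(N - Y \<union> A) \<inter> TV = {}"
      using N(4) UA YW TVW by blast
    moreover have "c ` (N - Y \<union> A) \<inter> TC = {}"
    proof -
      have "k \<notin> TC" if k: "k \<in> c ` (N - Y)" for k
      proof -
        have "k \<in> c ` N" "k \<notin> c ` Y" using k rem(2) by blast+
        then show ?thesis using N(5) unfolding TC'_def by blast
      qed
      then show ?thesis using xyz(3) unfolding cA[symmetric] by blast
    qed
    ultimately show ?thesis using N'(1) by blast
  qed
  show ?case
  proof (cases "TV \<subseteq> W")
    case False
    then obtain e where "rich K W C e" "partner (anchor K W C e) \<in> TV - W"
      using TV by (auto simp: next_V_def)
    then show ?thesis using rich_case by blast
  next
    case TVW: True
    show ?thesis
    proof (cases "TC \<subseteq> C")
      case True
      then show ?thesis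
        using fr[unfolded freeable_def, rule_format, OF TVW True Z fin _ ZV ZC] b by simp
    next
      case False
      then obtain k where "k \<in> TC - C" by blast
      then consider e where "rich K W C e" "k = c e" | u where "u \<in> VM" "u \<notin> W" "partner u \<notin> W"
          "L \<le> card (swaps W C u)" "k = c {u, partner u}"
        using TC \<open>k \<in> TC - C\<close> unfolding next_C_def by blast
      then show ?thesis
      proof cases
        case 1
        then show ?thesis using rich_case \<open>k \<in> TC - C\<close> by blast
      next
        case 2
        then show ?thesis using swap_case[of u] \<open>k \<in> TC - C\<close> TVW by blast
      qed
    qed
  qed
qed

text \<open>At most \<open>b\<close> demanded elements are new and each costs 8, so the old sets
  must afford \<open>b + 8 * b\<close>; this turns the factors 3 and 10 into 27 and 90.\<close>

lemma freeable_next: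
  assumes "freeable (9 * b) W C" "27 * b < K" "90 * b * (card VM)\<^sup>2 < L"
  shows "freeable b (next_V K W C) (next_C K L W C)"
  unfolding freeable_def
proof (intro allI impI)
  fix TV TC Z
  assume "TV \<subseteq> next_V K W C" "TC \<subseteq> next_C K L W C" "Z \<subseteq> M" "finite TV" "finite TC" "\<Union>Z \<inter> TV = {}" "c ` Z \<inter> TC = {}"
    and b: "card TV + card TC + card Z \<le> b"
  moreover have "card TV + card TC + card Z + 8 * (card (TV - W) + card (TC - C)) \<le> 9 * b"
    using b card_mono[of TV "TV - W"] card_mono[of TC "TC - C"] \<open>finite TV\<close> \<open>finite TC\<close> by simp
  ultimately show "\<exists>N. rainbow_matching E c N \<and> card N = card M \<and> Z \<subseteq> N \<and> \<Union>N \<inter> TV = {} \<and> c ` N \<inter> TC = {}"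
    using freeable_next_aux[OF assms(1), of K L TV TC Z] assms(2,3) by simp
qed

section \<open>Walks that are not exchanges\<close>

text \<open>A walk off \<open>W\<close> that is no exchange uses a colour of \<open>C' - C\<close>,
  meets {u, partner u} (at most 6 |VM|^2 walks), repeats a vertex up to \<open>partner\<close> (six
  cases) or repeats a colour (six cases). The last three kinds give 6 + 6 + 6 = 18.\<close>

lemma card_walks_le:
  assumes u: "u \<in> VM" and C: "C \<subseteq> C'" "finite (C' - C)"
  shows "card {(x, y, z) \<in> walks C' u. {x, partner x, y, partner y, z, partner z} \<inter> W = {}}
    \<le> card (swaps W C u) + 4 * card (C' - C) * (card VM)\<^sup>2 + 18 * (card VM)\<^sup>2"
proof -
  let ?n2 = "(card VM)\<^sup>2"
  let ?W = "walks C' u"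
  let ?A = "{(x, y, z) \<in> ?W. {x, partner x, y, partner y, z, partner z} \<inter> W = {}}"
  let ?F = "{w \<in> ?W. set (walk_colours u w) \<inter> (C' - C) \<noteq> {}}"
  let ?V = "{(x, y, z) \<in> ?W. {x, y, z} \<inter> {u, partner u} \<noteq> {}}"
  let ?D1 = "{(x, y, z) \<in> ?W. y = x}" and ?D2 = "{(x, y, z) \<in> ?W. y = partner x}"
  let ?D3 = "{(x, y, z) \<in> ?W. z = x}" and ?D4 = "{(x, y, z) \<in> ?W. z = partner x}"
  let ?D5 = "{(x, y, z) \<in> ?W. z = y}" and ?D6 = "{(x, y, z) \<in> ?W. z = partner y}"
  let ?P1 = "{(x, y, z) \<in> ?W. c {u, x} = c {partner x, partner y}}"
  let ?P2 = "{(x, y, z) \<in> ?W. c {u, x} = c {y, z}}"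
  let ?P3 = "{(x, y, z) \<in> ?W. c {u, x} = c {partner z, partner u}}"
  let ?P4 = "{(x, y, z) \<in> ?W. c {partner x, partner y} = c {y, z}}"
  let ?P5 = "{(x, y, z) \<in> ?W. c {partner x, partner y} = c {partner z, partner u}}"
  let ?P6 = "{(x, y, z) \<in> ?W. c {y, z} = c {partner z, partner u}}"
  have F: "card ?F \<le> 4 * card (C' - C) * ?n2" by (rule card_walks_colours[OF u C(2)])
  have "card {u, partner u} = 2" using u by simp
  then have V: "card ?V \<le> 6 * ?n2" using card_walks_vertices[of "{u, partner u}" C' u] by simp
  have D1: "card ?D1 \<le> ?n2"
    by (rule card_triples(2)[of _ C' u]) (auto simp: inj_on_def)
  have D2: "card ?D2 \<le> ?n2"
    by (rule card_triples(2)[of _ C' u]) (auto simp: inj_on_def)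
  have D3: "card ?D3 \<le> ?n2"
    by (rule card_triples(3)[of _ C' u]) (auto simp: inj_on_def)
  have D4: "card ?D4 \<le> ?n2"
    by (rule card_triples(3)[of _ C' u]) (auto simp: inj_on_def)
  have D5: "card ?D5 \<le> ?n2"
    by (rule card_triples(3)[of _ C' u]) (auto simp: inj_on_def)
  have D6: "card ?D6 \<le> ?n2"
    by (rule card_triples(3)[of _ C' u]) (auto simp: inj_on_def)
  have P1: "card ?P1 \<le> ?n2"
    by (rule card_triples(2)[of _ C' u]) (auto simp: inj_on_def intro: partner_colour_inj dest: walksD)
  have P2: "card ?P2 \<le> ?n2"
    by (rule card_triples(3)[of _ C' u]) (auto simp: inj_on_def intro: edge_colour_inj dest: walksD)
  have P3: "card ?P3 \<le> ?n2"
    by (rule card_triples(3)[of _ C' u]) (auto simp: inj_on_def intro: partner_colour_inj' dest: walksD)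
  have P4: "card ?P4 \<le> ?n2"
    by (rule card_triples(3)[of _ C' u]) (auto simp: inj_on_def intro: edge_colour_inj dest: walksD)
  have P5: "card ?P5 \<le> ?n2"
    by (rule card_triples(3)[of _ C' u]) (auto simp: inj_on_def intro: partner_colour_inj' dest: walksD)
  have edge_colour_inj': "y = y'" if "{y, z} \<in> E" "{y', z} \<in> E" "c {y, z} = c {y', z}" for y y' z
    using edge_colour_inj[of z y y'] that by (simp add: insert_commute)
  have P6: "card ?P6 \<le> ?n2"
    by (rule card_triples(2)[of _ C' u]) (auto simp: inj_on_def intro: edge_colour_inj' dest: walksD)
  let ?U = "swaps W C u \<union> ?F \<union> ?V \<union> ?D1 \<union> ?D2 \<union> ?D3 \<union> ?D4 \<union> ?D5 \<union> ?D6 \<union> ?P1 \<union> ?P2 \<union> ?P3 \<union> ?P4 \<union> ?P5 \<union> ?P6"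
  have "?A \<subseteq> ?U"
  proof
    fix w assume "w \<in> ?A"
    then obtain x y z where w: "w = (x, y, z)" "(x, y, z) \<in> ?W" "{x, partner x, y, partner y, z, partner z} \<inter> W = {}"
      by auto
    note VM = walksD(1-3)[OF w(2)] u
    show "w \<in> ?U"
    proof (rule ccontr)
      assume N: "w \<notin> ?U"
      have "distinct (walk_colours u (x, y, z))" using N w by auto
      moreover have "distinct [u, partner u, x, partner x, y, partner y, z, partner z]"
      proof -
        \<comment> \<open>These twelve inequalities suffice; the others follow because
          \<open>partner\<close> is an involution without fixed points on \<open>VM\<close>.\<close>
        have ne: "x \<noteq> u" "x \<noteq> partner u" "y \<noteq> u" "y \<noteq> partner u" "z \<noteq> u" "z \<noteq> partner u"
          "y \<noteq> x" "y \<noteq> partner x" "z \<noteq> x" "z \<noteq> partner x" "z \<noteq> y" "z \<noteq> partner y"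
          using N w by auto
        have sw': "a \<noteq> partner b" if "b \<noteq> partner a" "a \<in> VM" "b \<in> VM" for a b
          using that partner_partner[of b] by metis
        have pp: "partner a \<noteq> partner b" if "a \<noteq> b" "a \<in> VM" "b \<in> VM" for a b
          using that partner_eq_iff by blast
        have "partner x \<noteq> y" "partner x \<noteq> z" "partner y \<noteq> z" "partner u \<noteq> x" "partner u \<noteq> y" "partner u \<noteq> z"
          using ne by blast+
        then show ?thesis
          using ne sw'[of x u] sw'[of y u] sw'[of z u] sw'[of y x] sw'[of z x] sw'[of z y]
            pp[of x u] pp[of y u] pp[of z u] pp[of y x] pp[of z x] pp[of z y]
            VM partner_neq[of u] partner_neq[of x] partner_neq[of y] partner_neq[of z]
          by (simp del: Union_iff partner_neq)
      qed
      moreover have "(x, y, z) \<in> walks C u"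
      proof -
        have "w \<notin> ?F" using N by (simp only: Un_iff de_Morgan_disj simp_thms)
        then have "set (walk_colours u (x, y, z)) \<inter> (C' - C) = {}"
          using w(1,2) by (simp del: walk_colours.simps)
        moreover have "set (walk_colours u (x, y, z)) \<subseteq> C'" using w(2) by (auto simp: walks_def)
        ultimately have "set (walk_colours u (x, y, z)) \<subseteq> C" by blast
        then show ?thesis using w(2) by (auto simp: walks_def)
      qed
      ultimately have "(x, y, z) \<in> swaps W C u" using w(3) by (auto simp: swaps_def)
      then show False using N w(1) by (simp only: Un_iff de_Morgan_disj simp_thms)
    qed
  qed
  moreover have "finite ?U"
    by (intro finite_UnI finite_swaps) (rule finite_subset[OF _ finite_walks[of C' u]]; blast)+
  ultimately have "card ?A \<le> card ?U" by (intro card_mono)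
  also have "\<dots> \<le> card (swaps W C u) + card ?F + card ?V + card ?D1 + card ?D2 + card ?D3 + card ?D4 + card ?D5 + card ?D6
      + card ?P1 + card ?P2 + card ?P3 + card ?P4 + card ?P5 + card ?P6"
    by (intro order.trans[OF card_Un_le] add_mono card_Un_le order.refl)
  finally show ?thesis using F V D1 D2 D3 D4 D5 D6 P1 P2 P3 P4 P5 P6 by linarith
qed

section \<open>Counting edges after a round that frees little\<close>

text \<open>\<open>g\<close> counts the edges of \<open>M\<close> disjoint from \<open>W'\<close>, and \<open>t\<close> those among them with colour outside \<open>C'\<close>;
  \<open>Q\<close> counts the pairs \<open>(u, w)\<close> such that \<open>{u, w}\<close> and its image under \<^term>\<open>partner\<close> are both
  edges with colours in \<open>C'\<close>.\<close>
lemma count_edges: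
  fixes q s K L \<Delta> :: nat
  assumes deg: "\<And>x. card {e \<in> E. x \<in> e} \<le> \<Delta>"
    and class_le: "\<And>k. card {e \<in> E. c e = k} \<le> q"
    and base: "- VM \<subseteq> W" "- c ` M \<subseteq> C"
    and W': "W' = next_V K W C" and C': "C' = next_C K L W C"
    and closed: "\<And>e. e \<in> M \<Longrightarrow> e \<inter> W' \<noteq> {} \<Longrightarrow> c e \<in> C'"
    and fr: "freeable 3 W' C'"
    and small: "card (W' - W) \<le> s" "card (C' - C) \<le> s"
  obtains g t v Q :: nat where "g \<le> card M" "g = t + v"
    "2 * card E \<le> 2 * \<Delta> * (card M - g) + 2 * q * t + 4 * g * (K + 2 * s) + 4 * v\<^sup>2 + 2 * t\<^sup>2 + 4 * t * v + Q"
    "Q ^ 4 \<le> (2 * t) ^ 3 * (2 * g)\<^sup>2 * (L + 4 * s * (card VM)\<^sup>2 + 18 * (card VM)\<^sup>2)"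
proof -
  define R where "R = {e \<in> M. e \<inter> W' = {}}"
  define T where "T = {e \<in> R. c e \<notin> C'}"
  define VR where "VR = \<Union>R"
  define VT where "VT = \<Union>T"
  define g where "g = card R"
  define t where "t = card T"
  define v where "v = g - t"
  have RM: "R \<subseteq> M" and TR: "T \<subseteq> R" by (auto simp: R_def T_def)
  have finR: "finite R" using finite_subset[OF RM finite_M] .
  have finT: "finite T" using finite_subset[OF TR finR] .
  have gm: "g \<le> card M" using RM finite_M by (simp add: g_def card_mono)
  have tg: "t \<le> g" using TR finR by (simp add: g_def t_def card_mono)
  then have gtv: "g = t + v" by (simp add: v_def)
  have VRVM: "VR \<subseteq> VM" and VTVR: "VT \<subseteq> VR" using RM TR by (auto simp: VR_def VT_def)
  have finVR: "finite VR" using finite_subset[OF VRVM finite_VM] .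
  have finVT: "finite VT" using finite_subset[OF VTVR finVR] .
  have cVR: "card VR = 2 * g" using card_Union_M[OF RM] by (simp add: VR_def g_def)
  have cVT: "card VT = 2 * t" using card_Union_M[of T] RM TR by (auto simp: VT_def t_def)
  have WW': "W \<subseteq> W'" and CC': "C \<subseteq> C'" by (auto simp: W' C' next_V_def next_C_def)
  have VRW: "VR \<inter> W' = {}" by (auto simp: VR_def R_def)
  have R_partner: "{x, partner x} \<in> R" "partner x \<in> VR" if x: "x \<in> VR" for x
  proof -
    obtain e where e: "e \<in> R" "x \<in> e" using x by (auto simp: VR_def)
    then have "e = {x, partner x}" using M_edge_eq RM by blast
    then show "{x, partner x} \<in> R" "partner x \<in> VR" using e by (auto simp: VR_def)
  qed
  have T_partner: "{x, partner x} \<in> T" "partner x \<in> VT" if x: "x \<in> VT" for x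
  proof -
    obtain e where e: "e \<in> T" "x \<in> e" using x by (auto simp: VT_def)
    then have "e = {x, partner x}" using M_edge_eq RM TR by blast
    then show "{x, partner x} \<in> T" "partner x \<in> VT" using e by (auto simp: VT_def)
  qed

  \<comment> \<open>An edge of \<open>M\<close> outside \<open>R\<close> has an end in
    \<open>W'\<close>, so at most one of its ends is in \<open>X\<close>.\<close>
  define X where "X = VM - W' - VR"
  have cX: "card X \<le> card M - g"
  proof -
    have "X \<subseteq> (\<Union>e\<in>M - R. e - W')" by (auto simp: X_def VR_def)
    then have "card X \<le> card (\<Union>e\<in>M - R. e - W')"
      using finite_M finite_subset[OF _ finite_VM] by (intro card_mono finite_UN_I) auto
    also have "\<dots> \<le> (\<Sum>e\<in>M - R. card (e - W'))"
      using finite_M by (intro card_UN_le) auto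
    also have "\<dots> \<le> (\<Sum>e\<in>M - R. 1)"
    proof (rule sum_mono)
      fix e assume e: "e \<in> M - R"
      then have "card e = 2" using card_edge M_sub by blast
      moreover have "e - W' \<subset> e" using e by (auto simp: R_def)
      ultimately have "card (e - W') < 2"
        using psubset_card_mono[of e "e - W'"] card_ge_0_finite[of e] by simp
      then show "card (e - W') \<le> 1" by simp
    qed
    also have "\<dots> = card M - g" using RM finR by (simp add: g_def card_Diff_subset)
    finally show ?thesis .
  qed
  define FX where "FX = {e \<in> E. e \<inter> X \<noteq> {}}"
  have cFX: "card FX \<le> \<Delta> * (card M - g)"
  proof -
    have "finite X" using finite_VM by (auto simp: X_def)
    have "FX = (\<Union>x\<in>X. {e \<in> E. x \<in> e})" by (auto simp: FX_def)
    then have "card FX \<le> (\<Sum>x\<in>X. card {e \<in> E. x \<in> e})"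
      using card_UN_le[OF \<open>finite X\<close>] by simp
    also have "\<dots> \<le> (\<Sum>x\<in>X. \<Delta>)" by (intro sum_mono deg)
    also have "\<dots> = \<Delta> * card X" by simp
    also have "\<dots> \<le> \<Delta> * (card M - g)" using cX by (rule mult_le_mono2)
    finally show ?thesis .
  qed
  \<comment> \<open>This will catch all edges with colours outside \<open>C'\<close>: such a colour
    belongs to an edge of \<open>M\<close>, which by \<open>closed\<close> misses \<open>W'\<close>
    and so lies in \<open>T\<close>.\<close>
  define FT where "FT = {e \<in> E. c e \<in> c ` T}"
  have cFT: "card FT \<le> q * t"
  proof -
    have "FT = (\<Union>f\<in>T. {e \<in> E. c e = c f})" by (auto simp: FT_def)
    then have "card FT \<le> (\<Sum>f\<in>T. card {e \<in> E. c e = c f})"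
      using card_UN_le[OF finT] by simp
    also have "\<dots> \<le> (\<Sum>f\<in>T. q)" by (intro sum_mono class_le)
    finally show ?thesis by (simp add: t_def mult.commute)
  qed
  define FS where "FS = {{x, z} | x z. x \<in> VR \<and> z \<in> star W' C' x}"
  \<comment> \<open>With the old sets the star has fewer than \<open>K\<close> vertices, or else the
    edge at \<open>x\<close> would be rich and one of its ends would be in \<open>W'\<close>. The
    last round adds at most \<open>s\<close> vertices and \<open>s\<close> colours.\<close>
  have cstar: "card (star W' C' x) \<le> K + 2 * s" if x: "x \<in> VR" for x
  proof -
    have fin: "finite (C' - C)" using base(2) finite_M by (intro finite_subset[of "C' - C" "c ` M"]) auto
    have finW: "finite (W' - W)" using base(1) finite_VM by (intro finite_subset[of "W' - W" VM]) auto
    let ?N = "{z \<in> star W' C' x. c {x, z} \<in> C' - C}"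
    have "card ?N \<le> card (C' - C)"
      by (rule card_inj_on_le[of "\<lambda>z. c {x, z}"])
        (use fin in \<open>auto intro: inj_on_subset[OF inj_on_star]\<close>)
    moreover have "card (star W C x) < K"
    proof (rule ccontr)
      assume "\<not> card (star W C x) < K"
      then have r: "rich K W C {x, partner x}"
        using R_partner[OF x] WW' by (auto simp: rich_def R_def)
      then have "anchor K W C {x, partner x} \<in> {x, partner x}" using anchor by blast
      then have "partner (anchor K W C {x, partner x}) \<in> VR"
        using R_partner x by auto
      moreover have "partner (anchor K W C {x, partner x}) \<in> W'"
        using r by (auto simp: W' next_V_def)
      ultimately show False using VRW by blast
    qed
    moreover have "star W' C' x \<subseteq> star W C x \<union> (W' - W) \<union> ?N"
      by (auto simp: star_def)
    then have "card (star W' C' x) \<le> card (star W C x \<union> (W' - W) \<union> ?N)"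
      using finite_star finW by (intro card_mono) auto
    moreover have "card (star W C x \<union> (W' - W) \<union> ?N) \<le> card (star W C x) + card (W' - W) + card ?N"
      by (intro order.trans[OF card_Un_le] add_mono card_Un_le order.refl)
    ultimately show ?thesis using small by linarith
  qed
  have cFS: "card FS \<le> 2 * g * (K + 2 * s)"
  proof -
    have "FS = (\<Union>x\<in>VR. (\<lambda>z. {x, z}) ` star W' C' x)" by (auto simp: FS_def)
    then have "card FS \<le> (\<Sum>x\<in>VR. card ((\<lambda>z. {x, z}) ` star W' C' x))"
      using card_UN_le[OF finVR] by simp
    also have "\<dots> \<le> (\<Sum>x\<in>VR. K + 2 * s)"
      using cstar finite_star by (intro sum_mono) (meson card_image_le le_trans)
    also have "\<dots> = 2 * g * (K + 2 * s)" by (simp add: cVR)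
    finally show ?thesis .
  qed
  \<comment> \<open>The remaining edges lie inside \<open>VR\<close>. Those missing
    \<open>VT\<close> are bounded by all pairs, those meeting it (\<open>H\<close>) through the
    overlap of \<open>H\<close> with its image under \<open>partner\<close>.\<close>
  define FR where "FR = {e \<in> E. c e \<in> C' \<and> e \<subseteq> VR}"
  define H where "H = {e \<in> FR. e \<inter> VT \<noteq> {}}"
  define P where "P = {e. e \<subseteq> VR \<and> card e = 2 \<and> e \<inter> VT \<noteq> {}}"
  define \<Gamma> where "\<Gamma> = {(u, w) \<in> VT \<times> VR. {u, w} \<in> FR \<and> {partner u, partner w} \<in> FR}"
  have finFR: "finite FR" and finH: "finite H" using finite_E by (auto simp: FR_def H_def)
  have finP: "finite P" using finVR by (auto simp: P_def)
  have fin\<Gamma>: "finite \<Gamma>"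
    by (rule finite_subset[of _ "VT \<times> VR"]) (use finVT finVR in \<open>auto simp: \<Gamma>_def\<close>)
  have cVTR: "card (VR - VT) = 2 * v"
    using card_Diff_subset[OF finVT VTVR] cVR cVT gtv by simp
  have cP: "card P + 2 * v\<^sup>2 + g = 2 * g\<^sup>2 + v"
    using card_doubletons_meeting[OF finVR VTVR] even_choose_two[of g] even_choose_two[of v]
    unfolding P_def[symmetric] cVR cVTR by linarith
  have "card {e. e \<subseteq> VR - VT \<and> card e = 2} = (2 * v) choose 2"
    using n_subsets[of "VR - VT" 2] finVR cVTR by simp
  moreover have "card (FR - H) \<le> card {e. e \<subseteq> VR - VT \<and> card e = 2}"
    using finVR card_edge by (intro card_mono) (auto simp: FR_def H_def)
  ultimately have cFH: "card (FR - H) \<le> 2 * v\<^sup>2" using even_choose_two[of v] by linarith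
  \<comment> \<open>\<open>H\<close> and its image both lie in \<open>P\<close>, so 2 |H| is at most
    |P| plus the overlap, and each edge of the overlap yields a pair in
    \<open>\<Gamma>\<close>.\<close>
  let ?\<sigma> = "\<lambda>e. partner ` e"
  have injP: "inj_on partner VR" using inj_on_subset[OF inj_partner VRVM] .
  have inj: "inj_on ?\<sigma> H"
    using inj_on_image_eq_iff[OF injP] by (auto simp: inj_on_def H_def FR_def)
  have HP: "H \<subseteq> P" using card_edge by (auto simp: H_def FR_def P_def)
  have "?\<sigma> ` H \<subseteq> P"
  proof
    fix f assume "f \<in> ?\<sigma> ` H"
    then obtain e where e: "e \<in> P" "f = partner ` e" using HP by blast
    then have "card f = 2" using card_image[of partner e] inj_on_subset[OF injP] by (auto simp: P_def)
    then show "f \<in> P" using e R_partner(2) T_partner(2) by (fastforce simp: P_def)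
  qed
  then have "card (H \<union> ?\<sigma> ` H) \<le> card P" using HP finP by (intro card_mono) auto
  moreover have "card H + card (?\<sigma> ` H) = card (H \<union> ?\<sigma> ` H) + card (H \<inter> ?\<sigma> ` H)"
    using finH by (intro card_Un_Int) auto
  moreover have "card (?\<sigma> ` H) = card H" using inj by (rule card_image)
  moreover have "card (H \<inter> ?\<sigma> ` H) \<le> card \<Gamma>"
  proof -
    have "H \<inter> ?\<sigma> ` H \<subseteq> (\<lambda>(u, w). {u, w}) ` \<Gamma>"
    proof
      fix e assume e: "e \<in> H \<inter> ?\<sigma> ` H"
      then obtain f where f: "f \<in> H" "e = partner ` f" by blast
      obtain u where u: "u \<in> e" "u \<in> VT" using e by (auto simp: H_def)
      have "card e = 2" using e card_edge by (auto simp: H_def FR_def)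
      then obtain w where w: "e = {u, w}" using u(1) by (auto simp: card_2_iff)
      have eVR: "e \<subseteq> VR" using e by (auto simp: H_def FR_def)
      have fVR: "f \<subseteq> VR" using f by (auto simp: H_def FR_def)
      have "partner (partner x) = x" if "x \<in> f" for x
        using that fVR VRVM partner_partner[of x] by blast
      then have "partner ` e = f" using f(2) by (simp add: image_image)
      then have "f = {partner u, partner w}" unfolding w by simp
      then have "{partner u, partner w} \<in> FR" using f(1) by (simp add: H_def)
      then have "(u, w) \<in> \<Gamma>" using e u w eVR by (auto simp: \<Gamma>_def H_def)
      then show "e \<in> (\<lambda>(u, w). {u, w}) ` \<Gamma>" using w by force
    qed
    then show ?thesis using fin\<Gamma> by (meson card_image_le card_mono finite_imageI le_trans)
  qed
  ultimately have cH: "2 * card H \<le> card P + card \<Gamma>" by linarith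
  have cFR: "card FR \<le> card (FR - H) + card H"
    using card_Un_le[of "FR - H" H] by (simp add: H_def Un_absorb2 subset_iff)
  have "E \<subseteq> FX \<union> FT \<union> FS \<union> FR"
  proof
    fix e assume e: "e \<in> E"
    then obtain x z where xz: "e = {x, z}" using card_edge[of e] by (auto simp: card_2_iff)
    show "e \<in> FX \<union> FT \<union> FS \<union> FR"
    proof (cases "c e \<in> C'")
      case False
      then have "c e \<in> c ` M" using base(2) CC' by blast
      then obtain f where f: "f \<in> M" "c e = c f" by blast
      then have "f \<in> T" using closed[of f] False by (auto simp: T_def R_def)
      then show ?thesis using e f by (auto simp: FT_def)
    next
      case True
      have place: "y \<in> X \<or> y \<in> W' \<or> y \<in> VR" for y using base(1) WW' by (auto simp: X_def)
      \<comment> \<open>Here the maximality of \<open>M\<close> enters.\<close>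
      have "\<not> (x \<in> W' \<and> z \<in> W')"
        using freeable_no_edge[OF fr, of x z] e True xz by auto
      then consider "x \<in> X \<or> z \<in> X" | "x \<in> VR" "z \<in> W'" | "x \<in> W'" "z \<in> VR" | "x \<in> VR" "z \<in> VR"
        using place by blast
      then show ?thesis
      proof cases
        case 1
        then show ?thesis using e xz by (auto simp: FX_def)
      next
        case 2
        then show ?thesis using e xz True by (auto simp: FS_def star_def)
      next
        case 3
        have "e = {z, x}" using xz by auto
        then have "e \<in> FS" using 3 e True unfolding FS_def star_def by blast
        then show ?thesis by blast
      next
        case 4
        then show ?thesis using e xz True by (auto simp: FR_def)
      qed
    qed
  qed
  moreover have "finite FS"
  proof -
    have "FS = (\<Union>x\<in>VR. (\<lambda>z. {x, z}) ` star W' C' x)" by (auto simp: FS_def)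
    then show ?thesis using finVR finite_star by simp
  qed
  ultimately have "card E \<le> card (FX \<union> FT \<union> FS \<union> FR)"
    using finite_E finFR by (intro card_mono) (auto simp: FX_def FT_def)
  also have "\<dots> \<le> card FX + card FT + card FS + card FR"
    by (intro order.trans[OF card_Un_le] add_mono card_Un_le order.refl)
  finally have "2 * card E \<le> 2 * (\<Delta> * (card M - g)) + 2 * (q * t) + 2 * (2 * g * (K + 2 * s)) + 4 * v\<^sup>2 + card P + card \<Gamma>"
    using cFX cFT cFS cFR cFH cH by linarith
  moreover have "card P \<le> 2 * t\<^sup>2 + 4 * (t * v)"
  proof -
    have "2 * g\<^sup>2 = 2 * t\<^sup>2 + 4 * (t * v) + 2 * v\<^sup>2" by (simp add: gtv power2_sum algebra_simps)
    then show ?thesis using cP gtv by linarith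
  qed
  ultimately have E: "2 * card E \<le> 2 * \<Delta> * (card M - g) + 2 * q * t + 4 * g * (K + 2 * s) + 4 * v\<^sup>2 + 2 * t\<^sup>2 + 4 * t * v + card \<Gamma>"
    by (simp add: mult.assoc)

  have "card \<Gamma> ^ 4 \<le> card VT ^ 3 * (card VR)\<^sup>2 * (L + 4 * s * (card VM)\<^sup>2 + 18 * (card VM)\<^sup>2)"
  proof (rule four_cycle_count[OF finVT finVR])
    show "\<Gamma> \<subseteq> VT \<times> VR" by (auto simp: \<Gamma>_def)
    fix u assume u: "u \<in> VT"
    then have uVM: "u \<in> VM" using VTVR VRVM by blast
    let ?A = "{(w, u', w') \<in> VR \<times> VT \<times> VR. (u, w) \<in> \<Gamma> \<and> (u', w) \<in> \<Gamma> \<and> (u', w') \<in> \<Gamma> \<and> (u, w') \<in> \<Gamma>}"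
    let ?B = "{(x, y, z) \<in> walks C' u. {x, partner x, y, partner y, z, partner z} \<inter> W' = {}}"
    \<comment> \<open>Each pair in \<open>\<Gamma>\<close> gives an edge and its image; taking them
      alternately along the closed 4-walk gives the edges required by \<open>walks\<close>.\<close>
    have "?A \<subseteq> ?B"
    proof
      fix a assume "a \<in> ?A"
      then obtain w u' w' where a: "a = (w, u', w')" "w \<in> VR" "u' \<in> VT" "w' \<in> VR"
        "(u, w) \<in> \<Gamma>" "(u', w) \<in> \<Gamma>" "(u', w') \<in> \<Gamma>" "(u, w') \<in> \<Gamma>" by blast
      have "u' \<in> VR" using a(3) VTVR by blast
      have e: "{u, w} \<in> FR" "{partner w, partner u'} \<in> FR" "{u', w'} \<in> FR" "{partner w', partner u} \<in> FR"
        using a(5-8) by (auto simp: \<Gamma>_def insert_commute)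
      then have "(w, u', w') \<in> walks C' u"
        using a(2,4) \<open>u' \<in> VR\<close> VRVM unfolding walks_def by (auto simp: FR_def)
      moreover have "{w, partner w, u', partner u', w', partner w'} \<inter> W' = {}"
        using R_partner(2) a(2,4) \<open>u' \<in> VR\<close> VRW by auto
      ultimately show "a \<in> ?B" using a(1) by simp
    qed
    then have "card ?A \<le> card ?B"
      by (intro card_mono finite_subset[OF _ finite_walks[of C' u]]) auto
    also have "\<dots> \<le> card (swaps W' C u) + 4 * card (C' - C) * (card VM)\<^sup>2 + 18 * (card VM)\<^sup>2"
      using base(2) finite_M by (intro card_walks_le uVM CC' finite_subset[of "C' - C" "c ` M"]) auto
    \<comment> \<open>The edge at \<open>u\<close> is in \<open>T\<close>, so its colour was not
      freed, which bounds the exchanges at \<open>u\<close>; enlarging \<open>W\<close> only removes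
      exchanges.\<close>
    also have "card (swaps W' C u) \<le> L"
    proof -
      have "c {u, partner u} \<notin> C'" using T_partner(1)[OF u] by (simp add: T_def)
      moreover have "u \<notin> W" "partner u \<notin> W"
        using u T_partner(2)[OF u] VTVR VRW WW' by blast+
      ultimately have "card (swaps W C u) < L" using uVM by (force simp: C' next_C_def)
      moreover have "card (swaps W' C u) \<le> card (swaps W C u)"
        using WW' by (intro card_mono finite_swaps) (auto simp: swaps_def)
      ultimately show ?thesis by simp
    qed
    also have "4 * card (C' - C) * (card VM)\<^sup>2 \<le> 4 * s * (card VM)\<^sup>2"
      using small(2) by (intro mult_right_mono) auto
    finally show "card ?A \<le> L + 4 * s * (card VM)\<^sup>2 + 18 * (card VM)\<^sup>2" by simp
  qed
  then show ?thesis using that[OF gm gtv E] unfolding cVT cVR by blast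
qed

section \<open>Iterating the rounds until one frees little\<close>

fun layer :: "nat \<Rightarrow> nat \<Rightarrow> nat \<Rightarrow> 'v set \<times> 'c set" where
  "layer K L 0 = (- VM, - c ` M)"
| "layer K L (Suc i) = (case layer K L i of (W, C) \<Rightarrow> (next_V K W C, next_C K L W C))"

lemma layer_Suc:
  "fst (layer K L (Suc i)) = next_V K (fst (layer K L i)) (snd (layer K L i))"
  "snd (layer K L (Suc i)) = next_C K L (fst (layer K L i)) (snd (layer K L i))"
  by (auto split: prod.splits)

declare layer.simps(2) [simp del]

lemma layer_mono:
  "fst (layer K L i) \<subseteq> fst (layer K L (Suc i))" "snd (layer K L i) \<subseteq> snd (layer K L (Suc i))"
  by (auto simp: layer_Suc next_V_def next_C_def)

lemma layer_base: "- VM \<subseteq> fst (layer K L i) \<and> - c ` M \<subseteq> snd (layer K L i)"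
proof (induction i)
  case (Suc i)
  then show ?case using layer_mono[of K L i] by blast
qed simp

text \<open>A vertex of \<open>M\<close> becomes free only by a rotation of its edge, which frees
  the colour of that edge in the same round.\<close>

lemma layer_closed:
  "e \<in> M \<Longrightarrow> e \<inter> fst (layer K L i) \<noteq> {} \<Longrightarrow> c e \<in> snd (layer K L i)"
proof (induction i)
  case 0
  then show ?case by auto
next
  case (Suc i)
  let ?W = "fst (layer K L i)" and ?C = "snd (layer K L i)"
  show ?case
  proof (cases "e \<inter> ?W = {}")
    case False
    then show ?thesis using Suc layer_mono(2)[of K L i] by blast
  next
    case True
    then obtain f where f: "rich K ?W ?C f" "partner (anchor K ?W ?C f) \<in> e"
      using Suc.prems(2) by (auto simp: layer_Suc next_V_def)
    have fM: "f \<in> M" using f(1) by (simp add: rich_def)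
    have "partner (anchor K ?W ?C f) \<in> f"
      using M_edge_eq[OF fM anchor(1)[OF f(1)]] by blast
    then have "e = f" using M_edges_disjoint Suc.prems(1) fM f(2) by blast
    then show ?thesis using f(1) unfolding layer_Suc next_C_def by blast
  qed
qed

text \<open>The budget shrinks by a factor 9 per round. Starting from \<open>3 * 9 ^ J\<close>, it
  is still 3 after \<open>J\<close> rounds, as \<open>freeable_no_edge\<close> requires; 81 and 270
  are 3 times the factors 27 and 90.\<close>

lemma layer_freeable:
  assumes "81 * 9 ^ J < K" "270 * 9 ^ J * (card VM)\<^sup>2 < L"
  shows "i \<le> J \<Longrightarrow> freeable (3 * 9 ^ (J - i)) (fst (layer K L i)) (snd (layer K L i))"
proof (induction i)
  case 0
  then show ?case using freeable_initial by simp
next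
  case (Suc i)
  define b :: nat where "b = 3 * 9 ^ (J - Suc i)"
  have "J - i = Suc (J - Suc i)" using Suc.prems by simp
  then have "freeable (9 * b) (fst (layer K L i)) (snd (layer K L i))"
    using Suc by (simp add: b_def)
  moreover have b: "b \<le> 3 * 9 ^ J" by (simp add: b_def power_increasing)
  then have "27 * b < K" using assms(1) by simp
  moreover have "90 * b * (card VM)\<^sup>2 \<le> 270 * 9 ^ J * (card VM)\<^sup>2"
    using b by (intro mult_right_mono) auto
  then have "90 * b * (card VM)\<^sup>2 < L" using assms(2) by linarith
  ultimately show ?case unfolding layer_Suc b_def[symmetric] by (rule freeable_next)
qed

text \<open>At most \<open>2 * card M\<close> vertices and \<open>card M\<close> colours can ever be
  added, too few for \<open>J\<close> rounds that each add more than \<open>s\<close>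
  elements.\<close>

lemma layer_stabilizes:
  assumes "3 * card M < J * (s + 1)"
  obtains i where "i < J" "card (fst (layer K L (Suc i)) - fst (layer K L i)) \<le> s"
    "card (snd (layer K L (Suc i)) - snd (layer K L i)) \<le> s"
proof -
  \<comment> \<open>The free sets may be infinite, so only their parts among the vertices and
    colours of \<open>M\<close> are counted.\<close>
  define \<mu> where "\<mu> i = card (fst (layer K L i) \<inter> VM) + card (snd (layer K L i) \<inter> c ` M)" for i
  have fin: "finite (c ` M)" using finite_M by simp
  have incr: "\<mu> (Suc i) = \<mu> i + card (fst (layer K L (Suc i)) - fst (layer K L i))
      + card (snd (layer K L (Suc i)) - snd (layer K L i))" for i
  proof -
    have split: "card (B \<inter> U) = card (A \<inter> U) + card (B - A)" if "A \<subseteq> B" "- U \<subseteq> A" "finite U" for A B U :: "'x set"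
    proof -
      have "B \<inter> U = (A \<inter> U) \<union> (B - A)" using that by auto
      moreover have "finite (B - A)" using that by (intro finite_subset[of "B - A" U]) auto
      ultimately show ?thesis using that(3) by (simp add: card_Un_disjoint Int_Diff disjoint_iff)
    qed
    show ?thesis
      using split[OF layer_mono(1)[of K L i] conjunct1[OF layer_base[of K L i]] finite_VM]
        split[OF layer_mono(2)[of K L i] conjunct2[OF layer_base[of K L i]] fin]
      by (simp add: \<mu>_def)
  qed
  have "\<exists>i<J. \<mu> (Suc i) - \<mu> i \<le> s"
  proof (rule ccontr)
    assume "\<not> (\<exists>i<J. \<mu> (Suc i) - \<mu> i \<le> s)"
    then have step: "\<mu> i + (s + 1) \<le> \<mu> (Suc i)" if "i < J" for i using that by fastforce
    have "i \<le> J \<Longrightarrow> i * (s + 1) \<le> \<mu> i" for i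
    proof (induction i)
      case (Suc i)
      then show ?case using step[of i] by simp
    qed simp
    then have "J * (s + 1) \<le> \<mu> J" by simp
    also have "\<dots> \<le> card VM + card (c ` M)"
      unfolding \<mu>_def using finite_VM fin by (intro add_mono card_mono) auto
    also have "\<dots> \<le> 2 * card M + card M"
      using card_Union_M[of M] card_image_le[OF finite_M, of c] by simp
    finally show False using assms by simp
  qed
  then obtain i where i: "i < J" "\<mu> (Suc i) - \<mu> i \<le> s" by blast
  show ?thesis by (rule that[OF i(1)]) (use i(2) incr[of i] in linarith)+
qed

section \<open>The upper bound on the number of edges\<close>

text \<open>\<open>count_edges\<close> is applied with \<open>K = s\<close>. The stars contribute 12
  g s and the overlap \<open>Q\<close>, each at most \<epsilon> g q, and the other terms with
  \<open>t\<close> and \<open>v\<close> at most 4 g q. The total (4 + 2 \<epsilon>) g q is exactly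
  what the main term 2 (2 + \<epsilon>) q (|M| - g) falls short of 2 (2 + \<epsilon>) q |M|.\<close>

lemma card_edges_lt:
  fixes \<epsilon> \<delta> :: real and q J s :: nat
  assumes \<epsilon>: "\<epsilon> > 0" "12 * \<delta> \<le> \<epsilon>" "576 * \<delta> \<le> \<epsilon> ^ 4"
    and s: "real s \<le> \<delta> * real q" "1080 * 9 ^ J < s" "72 \<le> \<delta> * real q"
    and J: "3 * card M < J * (s + 1)" and mq: "card M \<le> q" and q: "0 < q"
    and deg: "\<And>x. card {e \<in> E. x \<in> e} \<le> \<Delta>" and \<Delta>: "real \<Delta> \<le> (2 + \<epsilon>) * real q"
    and class_le: "\<And>k. card {e \<in> E. c e = k} \<le> q"
  shows "real (card E) < (2 + \<epsilon>) * real q * real (card M + 1)"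
proof -
  \<comment> \<open>Large enough for \<open>layer_freeable\<close>, yet at most \<delta> q^3, so
    that the overlap stays small.\<close>
  define L where "L = s * q\<^sup>2"
  have VM2: "(card VM)\<^sup>2 \<le> 4 * q\<^sup>2"
    using card_Union_M[of M] mq by (simp add: power_mult_distrib)
  have "270 * 9 ^ J * (card VM)\<^sup>2 \<le> 270 * 9 ^ J * (4 * q\<^sup>2)"
    using VM2 by (intro mult_left_mono) auto
  also have "\<dots> = (1080 * 9 ^ J) * q\<^sup>2" by simp
  also have "\<dots> < L" unfolding L_def using s(2) q by (intro mult_strict_right_mono) auto
  finally have L: "270 * 9 ^ J * (card VM)\<^sup>2 < L" .
  have K: "81 * 9 ^ J < s" using s(2) by simp
  obtain i where i: "i < J" "card (fst (layer s L (Suc i)) - fst (layer s L i)) \<le> s"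
    "card (snd (layer s L (Suc i)) - snd (layer s L i)) \<le> s"
    using layer_stabilizes[OF J] .
  have "freeable (3 * 9 ^ (J - Suc i)) (fst (layer s L (Suc i))) (snd (layer s L (Suc i)))"
    using layer_freeable[OF K L, of "Suc i"] i(1) by simp
  then have fr: "freeable 3 (fst (layer s L (Suc i))) (snd (layer s L (Suc i)))"
    by (rule freeable_mono) simp
  obtain g t v Q :: nat where g: "g \<le> card M" "g = t + v"
    and E: "2 * card E \<le> 2 * \<Delta> * (card M - g) + 2 * q * t + 4 * g * (s + 2 * s) + 4 * v\<^sup>2 + 2 * t\<^sup>2 + 4 * t * v + Q"
    and Q: "Q ^ 4 \<le> (2 * t) ^ 3 * (2 * g)\<^sup>2 * (L + 4 * s * (card VM)\<^sup>2 + 18 * (card VM)\<^sup>2)"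
    by (rule count_edges[OF deg class_le _ _ layer_Suc(1) layer_Suc(2) layer_closed fr i(2,3)])
      (use layer_base in auto)
  have gq: "g \<le> q" and tg: "t \<le> g" using g mq by auto
  \<comment> \<open>With |VM| \<le> 2 q the sum is at most (17 s + 72) q^2, and \<open>s\<close> and
    72 are each at most \<delta> q.\<close>
  have B: "real (L + 4 * s * (card VM)\<^sup>2 + 18 * (card VM)\<^sup>2) \<le> 18 * \<delta> * real q ^ 3"
  proof -
    have "real (L + 4 * s * (card VM)\<^sup>2 + 18 * (card VM)\<^sup>2) = real s * real q ^ 2 + (4 * real s + 18) * real ((card VM)\<^sup>2)"
      by (simp add: L_def algebra_simps)
    also have "\<dots> \<le> real s * real q ^ 2 + (4 * real s + 18) * real (4 * q\<^sup>2)"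
      by (intro add_left_mono mult_left_mono of_nat_mono VM2) simp
    also have "\<dots> = (17 * real s + 72) * real q ^ 2" by (simp add: algebra_simps)
    also have "\<dots> \<le> (17 * (\<delta> * real q) + \<delta> * real q) * real q ^ 2"
      using s by (intro mult_right_mono) auto
    also have "\<dots> = 18 * \<delta> * real q ^ 3" by (simp add: power2_eq_square power3_eq_cube)
    finally show ?thesis .
  qed
  have \<delta>0: "0 \<le> \<delta>" using s(3) q by (smt (verit) mult_nonpos_nonneg of_nat_0_le_iff)
  have "real Q ^ 4 = real (Q ^ 4)" by simp
  also have "\<dots> \<le> real ((2 * t) ^ 3 * (2 * g)\<^sup>2 * (L + 4 * s * (card VM)\<^sup>2 + 18 * (card VM)\<^sup>2))"
    using Q by (simp only: of_nat_le_iff)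
  also have "\<dots> = 32 * real t ^ 3 * real g ^ 2 * real (L + 4 * s * (card VM)\<^sup>2 + 18 * (card VM)\<^sup>2)"
    by (simp add: power_mult_distrib)
  also have "\<dots> \<le> 32 * real t ^ 3 * real g ^ 2 * (18 * \<delta> * real q ^ 3)"
    using B by (intro mult_left_mono) auto
  also have "\<dots> \<le> 32 * real g ^ 3 * real g ^ 2 * (18 * \<delta> * real q ^ 3)"
    using tg \<delta>0 by (intro mult_right_mono mult_left_mono power_mono) auto
  also have "\<dots> = 576 * \<delta> * (real g ^ 4 * real q ^ 3) * real g"
    by (simp add: power2_eq_square power3_eq_cube power4_eq_xxxx)
  \<comment> \<open>One of the five factors \<open>g\<close> is traded for \<open>q\<close>, so that
    the fourth root is proportional to g q.\<close>
  also have "\<dots> \<le> 576 * \<delta> * (real g ^ 4 * real q ^ 3) * real q"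
    using gq \<delta>0 by (intro mult_left_mono) auto
  also have "\<dots> = 576 * \<delta> * (real g * real q) ^ 4"
    by (simp add: power3_eq_cube power4_eq_xxxx)
  also have "\<dots> \<le> \<epsilon> ^ 4 * (real g * real q) ^ 4"
    using \<epsilon>(3) by (intro mult_right_mono) auto
  also have "\<dots> = (\<epsilon> * (real g * real q)) ^ 4" by (simp add: power_mult_distrib)
  finally have "real Q ^ 4 \<le> (\<epsilon> * (real g * real q)) ^ 4" .
  moreover have "0 \<le> \<epsilon> * (real g * real q)" using \<epsilon>(1) by simp
  ultimately have Q': "real Q \<le> \<epsilon> * (real g * real q)"
    using power_mono_iff[of "real Q" "\<epsilon> * (real g * real q)" 4] by simp
  have "real (2 * card E) \<le> real (2 * \<Delta> * (card M - g) + 2 * q * t + 4 * g * (s + 2 * s) + 4 * v\<^sup>2 + 2 * t\<^sup>2 + 4 * t * v + Q)"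
    using E by (simp only: of_nat_le_iff)
  then have "2 * real (card E) \<le> 2 * real \<Delta> * real (card M - g) + 2 * real q * real t + 12 * real g * real s
      + (4 * real v ^ 2 + 2 * real t ^ 2 + 4 * real t * real v) + real Q" by simp
  also have "\<dots> \<le> 2 * ((2 + \<epsilon>) * real q) * real (card M - g) + 2 * real q * real t + 12 * real g * (\<delta> * real q)
      + 2 * real q * (real t + 2 * real v) + \<epsilon> * (real g * real q)"
  proof (intro add_mono Q' mult_right_mono mult_left_mono \<Delta> s(1) order.refl)
    \<comment> \<open>The decisive estimate, using t + v = g \<le> q: together with 2 q t the bound
      makes exactly 4 q g, whatever the split of \<open>g\<close>.\<close>
    have "4 * real v ^ 2 + 2 * real t ^ 2 + 4 * real t * real v \<le> 2 * (real t + real v) * (real t + 2 * real v)"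
      by (simp add: power2_eq_square algebra_simps)
    also have "\<dots> \<le> 2 * real q * (real t + 2 * real v)"
      using g gq by (intro mult_right_mono) auto
    finally show "4 * real v ^ 2 + 2 * real t ^ 2 + 4 * real t * real v \<le> 2 * real q * (real t + 2 * real v)" .
  qed auto
  also have "\<dots> = 2 * ((2 + \<epsilon>) * real q) * (real (card M) - real g) + (4 + 12 * \<delta> + \<epsilon>) * (real g * real q)"
    using g by (simp add: of_nat_diff algebra_simps)
  also have "\<dots> \<le> 2 * ((2 + \<epsilon>) * real q) * (real (card M) - real g) + (4 + \<epsilon> + \<epsilon>) * (real g * real q)"
    using \<epsilon>(2) by (intro add_left_mono mult_right_mono) auto
  also have "\<dots> = 2 * ((2 + \<epsilon>) * real q * real (card M))" by (simp add: algebra_simps)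
  finally have "real (card E) \<le> (2 + \<epsilon>) * real q * real (card M)" by simp
  also have "\<dots> < (2 + \<epsilon>) * real q * real (card M + 1)" using \<epsilon>(1) q by simp
  finally show ?thesis .
qed

end

section \<open>Choice of constants and conclusion\<close>

theorem theorem2p16:
  fixes \<epsilon> :: real
  assumes "\<epsilon> > 0"
  shows "\<exists>q0::nat. \<forall>q\<ge>q0. \<forall>(r::nat) (V :: 'v set) E (C :: 'c set) c.
           r \<le> q \<longrightarrow>
           simple_graph V E \<longrightarrow>
           proper_edge_coloring E C c \<longrightarrow>
           finite C \<and> real (card C) \<le> (2 + \<epsilon>) * real q \<longrightarrow>
           (\<forall>k\<in>C. finite {e \<in> E. c e = k} \<and> card {e \<in> E. c e = k} \<le> q) \<longrightarrow>
           real (card E) \<ge> (2 + \<epsilon>) * real q * real r \<longrightarrow>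
           (\<exists>M. rainbow_matching E c M \<and> finite M \<and> card M = r)"
proof -
  \<comment> \<open>The first bound controls the stars, the second the fourth root of the
    overlap.\<close>
  define \<delta> where "\<delta> = min (\<epsilon> / 12) (\<epsilon> ^ 4 / 576)"
  have \<delta>: "\<delta> > 0" "12 * \<delta> \<le> \<epsilon>" "576 * \<delta> \<le> \<epsilon> ^ 4" using assms by (auto simp: \<delta>_def)
  \<comment> \<open>As \<open>s\<close> will be the floor of \<delta> q, this makes J (s + 1) > 3 q,
    more than all rounds together can add.\<close>
  define J where "J = nat \<lceil>3 / \<delta>\<rceil>"
  \<comment> \<open>\<open>J\<close> depends on \<epsilon> alone, so \<open>q0\<close> does too. The
    72 serves \<open>card_edges_lt\<close> and absorbs the rounding in \<open>s\<close>.\<close>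
  define q0 where "q0 = nat \<lceil>(1080 * 9 ^ J + 72) / \<delta>\<rceil>"
  have main: "\<exists>M. rainbow_matching E c M \<and> finite M \<and> card M = r"
    if q0: "q \<ge> q0" and rq: "r \<le> q" and simple: "simple_graph V E" and col: "proper_edge_coloring E C c"
      and C: "finite C" "real (card C) \<le> (2 + \<epsilon>) * real q"
      and cls: "\<forall>k\<in>C. finite {e \<in> E. c e = k} \<and> card {e \<in> E. c e = k} \<le> q"
      and E: "real (card E) \<ge> (2 + \<epsilon>) * real q * real r"
    for q r :: nat and V :: "'v set" and E and C :: "'c set" and c
  proof -
    have "(1080 * 9 ^ J + 72) / \<delta> \<le> real q" using q0 unfolding q0_def by linarith
    then have \<delta>q: "1080 * 9 ^ J + 72 \<le> \<delta> * real q" using \<delta>(1) by (simp add: field_simps)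
    have "(0::real) \<le> 9 ^ J" by simp
    then have \<delta>q72: "72 \<le> \<delta> * real q" using \<delta>q by linarith
    then have q: "0 < q" by (cases "q = 0") auto
    define s where "s = nat \<lfloor>\<delta> * real q\<rfloor>"
    have "real s = real_of_int \<lfloor>\<delta> * real q\<rfloor>" unfolding s_def using \<delta>q72 by simp
    then have s: "real s \<le> \<delta> * real q" "\<delta> * real q < real s + 1" by linarith+
    have "real (1080 * 9 ^ J) < real s" using s(2) \<delta>q by simp
    then have s': "1080 * 9 ^ J < s" by (simp only: of_nat_less_iff)
    have EC: "c ` E \<subseteq> C" using col by (simp add: proper_edge_coloring_def)
    have "E = (\<Union>k\<in>C. {e \<in> E. c e = k})" using EC by auto
    moreover have "finite (\<Union>k\<in>C. {e \<in> E. c e = k})" using C(1) cls by blast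
    ultimately have finE: "finite E" by simp
    have "rainbow_matching E c {}" by (simp add: rainbow_matching_def matching_def disjoint_def)
    moreover have "\<forall>N. rainbow_matching E c N \<longrightarrow> card N \<le> card E"
      using finE by (auto simp: rainbow_matching_def matching_def intro: card_mono)
    ultimately obtain M where M: "rainbow_matching E c M" "\<And>N. rainbow_matching E c N \<Longrightarrow> card N \<le> card M"
      using ex_has_greatest_nat[of "rainbow_matching E c" "{}" card "Suc (card E)"]
      by (auto simp: less_Suc_eq_le)
    interpret max_rainbow_matching E c M
      by standard (use finE M simple col in \<open>auto simp: simple_graph_def proper_edge_coloring_def\<close>)
    have "r \<le> card M"
    proof (rule ccontr)
      assume "\<not> r \<le> card M"
      then have mr: "card M + 1 \<le> r" by simp
      have J: "3 * card M < J * (s + 1)"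
      proof -
        have "3 * real q = 3 / \<delta> * (\<delta> * real q)" using \<delta>(1) by simp
        also have "\<dots> < 3 / \<delta> * (real s + 1)" using \<delta>(1) s(2) by (intro mult_strict_left_mono) auto
        also have "\<dots> \<le> real J * (real s + 1)"
          unfolding J_def by (intro mult_right_mono) linarith+
        finally have "real (3 * q) < real (J * (s + 1))" by (simp add: algebra_simps)
        then have "3 * q < J * (s + 1)" by (simp only: of_nat_less_iff)
        then show ?thesis using mr rq by linarith
      qed
      have "real (card E) < (2 + \<epsilon>) * real q * real (card M + 1)"
      proof (rule card_edges_lt[OF assms \<delta>(2,3) s(1) s' _ J _ q _ C(2)])
        show "72 \<le> \<delta> * real q" by (rule \<delta>q72)
        show "card M \<le> q" using mr rq by simp
        \<comment> \<open>The colours at a vertex are distinct, so the palette size bounds every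
          degree.\<close>
        show "card {e \<in> E. x \<in> e} \<le> card C" for x
        proof (rule card_inj_on_le[OF _ _ C(1)])
          show "inj_on c {e \<in> E. x \<in> e}" using proper by (fastforce simp: inj_on_def)
        qed (use EC in auto)
        show "card {e \<in> E. c e = k} \<le> q" for k
        proof (cases "k \<in> C")
          case False
          then have "{e \<in> E. c e = k} = {}" using EC by auto
          then show ?thesis by (simp only: card.empty)
        qed (use cls in auto)
      qed
      also have "\<dots> \<le> (2 + \<epsilon>) * real q * real r"
        using mr assms by (intro mult_left_mono) auto
      finally show False using E by simp
    qed
    \<comment> \<open>Rainbow matchings are closed under subsets, so the size can be cut down to
      exactly \<open>r\<close>.\<close>
    then obtain N where N: "N \<subseteq> M" "card N = r" using obtain_subset_with_card_n by blast
    have "rainbow_matching E c N"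
      using M_sub disjoint_M inj_c_M N(1)
      by (auto simp: rainbow_matching_def matching_def disjoint_def intro: inj_on_subset)
    then show ?thesis using N finite_rainbow_matching by blast
  qed
  show ?thesis using main by blast
qed

end
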